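(* (Subject reduction for the resource $\lambda$-calculus $\lambda_{\mathtt C}$.) Let $M, M'$ be $\lambda_{\mathtt C}$-terms, $\Theta$ an unrestricted context, $\Gamma$ a linear context and $\tau$ a strict type. If $\Theta;\Gamma\models M:\tau$ (well-formedness) and $M\longrightarrow M'$, then $\Theta;\Gamma\models M':\tau$.
   Context: **Syntax of $\lambda_{\mathtt C}$.** Variables $x,y,\dots$ have linear occurrences $x$ (also written $x[\mathtt l]$) and unrestricted occurrences $x[i]$, $i\in\mathbb N$ (written $x^!$ when $i$ is unimportant). $\tilde x$ denotes a finite sequence of pairwise distinct (linear) variables, of length $|\tilde x|$. Terms: $M,N,L ::= x \mid x[i] \mid \lambda x.M \mid (M\,B) \mid \mathtt{fail}^{\tilde x} \mid M[\tilde x\leftarrow x]$ (sharing) $\mid M\langle\langle B/x\rangle\rangle$ (intermediate substitution) $\mid M\langle|C/\tilde x|\rangle$ (linear substitution) $\mid M\lfloor U/x\rceil$ (unrestricted substitution). Bags: $A,B ::= C\star U$. Linear bags: $C,D ::= \mathtt 1\mid\langle M\rangle\cdot C$ (finite multisets of terms; $\mathtt 1$ is empty; $C_i$ is the $i$-th element, $\mathrm{size}(C)$ the number of elements, $C\setminus C_i$ removes it). Unrestricted bags: $U,V ::= \mathtt 1^!\mid\langle M\rangle^!\mid U\diamond V$ (ordered lists; $\diamond$ is non-commutative; $U_i$ is the singleton bag at position $i$, defaulting to $\mathtt 1^!$ if there is no $i$-th position). Contexts: $\mathcal C ::= [\cdot]\mid(\mathcal C\,B)\mid\mathcal C\langle|C/\tilde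 x|\rangle\mid\mathcal C\lfloor U/x\rceil\mid\mathcal C[\tilde x\leftarrow x]$. $\lambda x.M$ and $M\langle\langle B/x\rangle\rangle$ bind $x$ in $M$; $M[\tilde x\leftarrow x]$ binds the shared variables $\tilde x$ in $M$ ($x$, the sharing variable, is free); $M\langle|C/\tilde x|\rangle$ binds $\tilde x$ in $M$; $M\lfloor U/x\rceil$ binds $x^!$ in $M$. Syntactic conditions: in $M[\tilde x\leftarrow x]$ each $x_i\in\tilde x$ occurs exactly once in $M$ and is not a sharing variable; in $M\langle|C/\tilde x|\rangle$, $\mathrm{size}(C)=|\tilde x|$ and each $x_i$ occurs in $M$, is not a sharing variable, and does not occur in another explicit substitution in $M$; in $M\lfloor U/x\rceil$, $x^!$ does not appear in another unrestricted substitution in $M$. $\mathsf{lfv}(\cdot)$ is the set of free linear variables (those of $\mathtt{fail}^{\tilde x}$ being $\tilde x$). **Head.** $\mathsf{head}(x)=x$; $\mathsf{head}(x[i])=x[i]$; $\mathsf{head}(\lambda x.M)=\lambda x.M$; $\mathsf{head}(M\,B)=\mathsf{head}(M)$; $\mathsf{head}(\mathtt{fail}^{\tilde x})=\mathtt{fail}^{\tilde x}$; $\mathsf{head}(M\langle\langle B/x\rangle\rangle)=M\langle\langle B/x\rangle\rangle$; $\mathsf{head}(M\langle|C/\tilde x|\rangle)=\mathsf{head}(M)$; $\mathsf{head}(M\lfloor U/x\rceil)=\mathsf{head}(M)$; $\mathsf{head}(M[\tilde x\leftarrow x])=x$ if $\mathsf{head}(M)=y\in\tilde x$, and $\mathsf{head}(M)$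 otherwise. $M\{N/x\}$ (resp. $M\{N/x[i]\}$) replaces the head occurrence of $x$ (resp. $x[i]$) in $M$ by $N$. **Reduction** $\longrightarrow$: - [Beta] $(\lambda x.M)\,B\longrightarrow M\langle\langle B/x\rangle\rangle$ - [Ex-Sub] $(M[\tilde x\leftarrow x])\langle\langle C\star U/x\rangle\rangle\longrightarrow M\langle|C/\tilde x|\rangle\lfloor U/x\rceil$ if $\mathrm{size}(C)=|\tilde x|$ and $M\neq\mathtt{fail}^{\tilde y}$ - [Fetch$^\ell$] $M\langle|C/\tilde x,x_j|\rangle\longrightarrow(M\{C_i/x_j\})\langle|(C\setminus C_i)/\tilde x|\rangle$ if $\mathsf{head}(M)=x_j$, $0<i\le\mathrm{size}(C)$ - [Fail$^\ell$] $(M[\tilde x\leftarrow x])\langle\langle C\star U/x\rangle\rangle\longrightarrow\mathtt{fail}^{\tilde y}$ if $\mathrm{size}(C)\neq|\tilde x|$ and $\tilde y=(\mathsf{lfv}(M)\setminus\tilde x)\cup\mathsf{lfv}(C)$ - [Fetch$^!$] $M\lfloor U/x\rceil\longrightarrow M\{N/x[i]\}\lfloor U/x\rceil$ if $\mathsf{head}(M)=x[i]$, $U_i=\langle N\rangle^!$ - [Fail$^!$] $M\lfloor U/x\rceil\longrightarrow M\{\mathtt{fail}^\emptyset/x[i]\}\lfloor U/x\rceil$ if $\mathsf{head}(M)=x[i]$, $U_i=\mathtt 1^!$ - [Cons$_1$] $\mathtt{fail}^{\tilde x}\,(C\star U)\longrightarrow\mathtt{fail}^{\tilde x\cup\tilde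 y}$ with $\tilde y=\mathsf{lfv}(C)$ - [Cons$_2$] $(\mathtt{fail}^{\tilde x\cup\tilde y}[\tilde x\leftarrow x])\langle\langle C\star U/x\rangle\rangle\longrightarrow\mathtt{fail}^{\tilde y\cup\tilde z}$ if $\mathrm{size}(C)=|\tilde x|$, $\tilde z=\mathsf{lfv}(C)$ - [Cons$_3$] $\mathtt{fail}^{\tilde y\cup\tilde x}\langle|C/\tilde x|\rangle\longrightarrow\mathtt{fail}^{\tilde y\cup\tilde z}$ with $\tilde z=\mathsf{lfv}(C)$ - [Cons$_4$] $\mathtt{fail}^{\tilde y}\lfloor U/x\rceil\longrightarrow\mathtt{fail}^{\tilde y}$ - [TCont] $M\longrightarrow N$ implies $\mathcal C[M]\longrightarrow\mathcal C[N]$. **Types.** Strict types $\sigma,\tau,\delta ::= \mathbf{unit}\mid(\pi,\eta)\to\sigma$. Multiset types $\pi,\zeta ::= \bigwedge_{i\in I}\sigma_i\mid\omega$ ($\wedge$ is associative, commutative, non-idempotent, with identity $\omega$; $\sigma^k$ is the $k$-fold $\sigma\wedge\dots\wedge\sigma$, and $\sigma^0=\omega$). List types $\eta,\epsilon ::= \sigma\mid\epsilon\diamond\eta$, i.e. non-empty lists $\sigma_1\diamond\dots\diamond\sigma_n$, with $\eta_i$ the $i$-th entry. Tuple types $(\pi,\eta)$. $\eta\sim\epsilon$ ("$\epsilon$ embraces $\eta$"): $\eta$ is a prefix of the list $\epsilon$ (possibly all of it). Linear contexts $\Gamma,\Delta ::= -\mid\Gamma,x:\pi\mid\Gamma,x:\sigma$;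 unrestricted contexts $\Theta ::= -\mid\Theta,x^!:\eta$; each variable occurs at most once in each; $-$ is empty. The core context $\Gamma^\downarrow$ drops all assignments $x:\omega$ from $\Gamma$. Judgments are of the form $\Theta;\Gamma\models M:\tau$ (similarly for bags). **Well-formedness rules:** - [var$^\ell$] $\Theta;x:\sigma\models x:\sigma$ - [var$^!$] $\Theta,x^!:\eta;x:\eta_i,\Delta\models x:\sigma$ implies $\Theta,x^!:\eta;\Delta\models x[i]:\sigma$ - [$\mathtt 1^\ell$] $\Theta;-\models\mathtt 1:\omega$ - [bag$^\ell$] $\Theta;\Gamma\models M:\sigma$ and $\Theta;\Delta\models C:\sigma^k$ imply $\Theta;\Gamma,\Delta\models\langle M\rangle\cdot C:\sigma^{k+1}$ - [$\mathtt 1^!$] $\Theta;-\models\mathtt 1^!:\sigma$ - [single$^!$] $\Theta;-\models M:\sigma$ implies $\Theta;-\models\langle M\rangle^!:\sigma$ - [bag$^!$] $\Theta;-\models U:\epsilon$ and $\Theta;-\models V:\eta$ imply $\Theta;-\models U\diamond V:\epsilon\diamond\eta$ - [bag] $\Theta;\Gamma\models C:\sigma^k$ and $\Theta;-\models U:\eta$ imply $\Theta;\Gamma\models C\star U:(\sigma^k,\eta)$ - [fail] $\mathrm{dom}(\Gamma^\downarrow)=\tilde x$ implies $\Theta;\Gamma^\downarrow\models\mathtt{fail}^{\tilde x}:\tau$ - [weak] $\Theta;\Gamma\models M:\tau$ implies $\Theta;\Gamma,x:\omega\models M[\leftarrow x]:\tau$ - [shar] $\Theta;\Gamma,x_1:\sigma,\dots,x_k:\sigma\models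 M:\tau$, $x\notin\mathrm{dom}(\Gamma)$, $k\neq0$ imply $\Theta;\Gamma,x:\sigma^k\models M[x_1,\dots,x_k\leftarrow x]:\tau$ - [abs-sh] $\Theta,x^!:\eta;\Gamma,x:\sigma^k\models M[\tilde x\leftarrow x]:\tau$ and $x\notin\mathrm{dom}(\Gamma)$ imply $\Theta;\Gamma\models\lambda x.(M[\tilde x\leftarrow x]):(\sigma^k,\eta)\to\tau$ - [app] $\Theta;\Gamma\models M:(\sigma^j,\eta)\to\tau$, $\Theta;\Delta\models B:(\sigma^k,\epsilon)$, $\eta\sim\epsilon$ imply $\Theta;\Gamma,\Delta\models(M\,B):\tau$ - [Esub$^!$] $\Theta,x^!:\eta;\Gamma\models M:\tau$, $\Theta;-\models U:\epsilon$, $\eta\sim\epsilon$ imply $\Theta;\Gamma\models M\lfloor U/x\rceil:\tau$ - [Esub] $\Theta,x^!:\eta;\Gamma,x:\sigma^j\models M[\tilde x\leftarrow x]:\tau$, $\Theta;\Delta\models B:(\sigma^k,\epsilon)$, $\eta\sim\epsilon$ imply $\Theta;\Gamma,\Delta\models(M[\tilde x\leftarrow x])\langle\langle B/x\rangle\rangle:\tau$ - [Esub$^\ell$] $\Theta;\Gamma,x_1:\sigma,\dots,x_k:\sigma\models M:\tau$ and $\Theta;\Delta\models C:\sigma^k$ imply $\Theta;\Gamma,\Delta\models M\langle|C/x_1,\dots,x_k|\rangle:\tau$.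
   Formalization: Added premise: no variable z with z:ω in Γ occurs free in a fail annotation of M'. Without it the claim fails: y:unit, z:ω ⊨ fail^∅ (⟨y[←z]⟩⋆1^!) reduces to fail^{y,z}, not well-formed there. The premise is necessary for the conclusion. *)

theory Defs
  imports "HOL-Library.Multiset" "HOL-Library.FSet" "HOL-Library.Sublist"
begin

section \<open>Syntax\<close>

type_synonym var = nat

text \<open>Non-empty lists: unrestricted bags \<open>U\<close> and list types \<open>\<eta>\<close> are never empty.\<close>

datatype 'a nelist = NE 'a "'a list"

primrec list_of :: "'a nelist \<Rightarrow> 'a list" where
  "list_of (NE x xs) = x # xs"

primrec ne_append :: "'a nelist \<Rightarrow> 'a nelist \<Rightarrow> 'a nelist" (infixr \<open>\<diamondop>\<close> 65) where
  "(NE x xs) \<diamondop> V = NE x (xs @ list_of V)"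

text \<open>
  \<open>\<diamondop>\<close> is read as associative, so an unrestricted bag is the non-empty list of its components:
  \<open>None\<close> stands for \<open>1\<^sup>!\<close> and \<open>Some M\<close> for the singleton of \<open>M\<close>. A linear bag \<open>C\<close> is a finite
  multiset, and a bag is always a pair \<open>C \<star> U\<close>, whose two components are given
  as separate arguments.

  \<^item> \<open>UVar x i\<close> is \<open>x[i]\<close>;
  \<^item> \<open>Share M xs x\<close> is \<open>M[xs \<leftarrow> x]\<close>;
  \<^item> \<open>ISub M C U x\<close> is the intermediate substitution of \<open>C \<star> U\<close> for \<open>x\<close> in \<open>M\<close>;
  \<^item> \<open>LSub M C xs\<close> and \<open>USub M U x\<close> are the linear and unrestricted substitutions.

  A name \<open>x\<close> has two independent kinds of occurrences, linear ones (\<open>x\<close>) and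
  unrestricted ones (\<open>x[i]\<close>). \<open>Lam\<close> and \<open>ISub\<close> bind both kinds, \<open>Share\<close> and \<open>LSub\<close> only linear
  ones, \<open>USub\<close> only unrestricted ones.
\<close>

datatype trm =
    Var var
  | UVar var nat
  | Lam var trm
  | App trm "trm multiset" "trm option nelist"
  | Fail "var fset"
  | Share trm "var list" var
  | ISub trm "trm multiset" "trm option nelist" var
  | LSub trm "trm multiset" "var list"
  | USub trm "trm option nelist" var

type_synonym lbag = "trm multiset"
type_synonym ubag = "trm option nelist"

text \<open>Positions in unrestricted bags and list types are counted from 1.\<close>

definition ubag_at :: "ubag \<Rightarrow> nat \<Rightarrow> trm option" where
  "ubag_at U i = (if 1 \<le> i \<and> i \<le> length (list_of U) then list_of U ! (i - 1) else None)"


section \<open>Free variables\<close>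

primrec lfv :: "trm \<Rightarrow> var set" where
  "lfv (Var x) = {x}"
| "lfv (UVar x i) = {}"
| "lfv (Lam x M) = lfv M - {x}"
| "lfv (App M C U) = lfv M \<union> \<Union> (set_mset (image_mset lfv C))
     \<union> \<Union> (\<Union> (set_option ` set (list_of (map_nelist (map_option lfv) U))))"
| "lfv (Fail X) = fset X"
| "lfv (Share M xs x) = (lfv M - set xs) \<union> {x}"
| "lfv (ISub M C U x) = (lfv M - {x}) \<union> \<Union> (set_mset (image_mset lfv C))
     \<union> \<Union> (\<Union> (set_option ` set (list_of (map_nelist (map_option lfv) U))))"
| "lfv (LSub M C xs) = (lfv M - set xs) \<union> \<Union> (set_mset (image_mset lfv C))"
| "lfv (USub M U x) = lfv M
     \<union> \<Union> (\<Union> (set_option ` set (list_of (map_nelist (map_option lfv) U))))"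

abbreviation lfv_lbag :: "lbag \<Rightarrow> var set" where
  "lfv_lbag C \<equiv> (\<Union>N\<in>set_mset C. lfv N)"

text \<open>Free unrestricted variables: the names \<open>x\<close> such that some \<open>x[i]\<close> occurs free.\<close>

primrec ufv :: "trm \<Rightarrow> var set" where
  "ufv (Var x) = {}"
| "ufv (UVar x i) = {x}"
| "ufv (Lam x M) = ufv M - {x}"
| "ufv (App M C U) = ufv M \<union> \<Union> (set_mset (image_mset ufv C))
     \<union> \<Union> (\<Union> (set_option ` set (list_of (map_nelist (map_option ufv) U))))"
| "ufv (Fail X) = {}"
| "ufv (Share M xs x) = ufv M"
| "ufv (ISub M C U x) = (ufv M - {x}) \<union> \<Union> (set_mset (image_mset ufv C))
     \<union> \<Union> (\<Union> (set_option ` set (list_of (map_nelist (map_option ufv) U))))"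
| "ufv (LSub M C xs) = ufv M \<union> \<Union> (set_mset (image_mset ufv C))"
| "ufv (USub M U x) = (ufv M - {x})
     \<union> \<Union> (\<Union> (set_option ` set (list_of (map_nelist (map_option ufv) U))))"

abbreviation ufv_lbag :: "lbag \<Rightarrow> var set" where
  "ufv_lbag C \<equiv> (\<Union>N\<in>set_mset C. ufv N)"

text \<open>Free variables that act as the sharing variable \<open>x\<close> of some \<open>M[xs \<leftarrow> x]\<close>.\<close>

primrec sharing_vars :: "trm \<Rightarrow> var set" where
  "sharing_vars (Var x) = {}"
| "sharing_vars (UVar x i) = {}"
| "sharing_vars (Lam x M) = sharing_vars M - {x}"
| "sharing_vars (App M C U) = sharing_vars M \<union> \<Union> (set_mset (image_mset sharing_vars C))
     \<union> \<Union> (\<Union> (set_option ` set (list_of (map_nelist (map_option sharing_vars) U))))"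
| "sharing_vars (Fail X) = {}"
| "sharing_vars (Share M xs x) = (sharing_vars M - set xs) \<union> {x}"
| "sharing_vars (ISub M C U x) = (sharing_vars M - {x})
     \<union> \<Union> (set_mset (image_mset sharing_vars C))
     \<union> \<Union> (\<Union> (set_option ` set (list_of (map_nelist (map_option sharing_vars) U))))"
| "sharing_vars (LSub M C xs) = (sharing_vars M - set xs)
     \<union> \<Union> (set_mset (image_mset sharing_vars C))"
| "sharing_vars (USub M U x) = sharing_vars M
     \<union> \<Union> (\<Union> (set_option ` set (list_of (map_nelist (map_option sharing_vars) U))))"

text \<open>Free variables that are recorded in the annotation of some \<open>fail\<close>.\<close>

primrec fail_vars :: "trm \<Rightarrow> var set" where
  "fail_vars (Var x) = {}"
| "fail_vars (UVar x i) = {}"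
| "fail_vars (Lam x M) = fail_vars M - {x}"
| "fail_vars (App M C U) = fail_vars M \<union> \<Union> (set_mset (image_mset fail_vars C))
     \<union> \<Union> (\<Union> (set_option ` set (list_of (map_nelist (map_option fail_vars) U))))"
| "fail_vars (Fail X) = fset X"
| "fail_vars (Share M xs x) = fail_vars M - set xs"
| "fail_vars (ISub M C U x) = (fail_vars M - {x}) \<union> \<Union> (set_mset (image_mset fail_vars C))
     \<union> \<Union> (\<Union> (set_option ` set (list_of (map_nelist (map_option fail_vars) U))))"
| "fail_vars (LSub M C xs) = (fail_vars M - set xs) \<union> \<Union> (set_mset (image_mset fail_vars C))"
| "fail_vars (USub M U x) = fail_vars M
     \<union> \<Union> (\<Union> (set_option ` set (list_of (map_nelist (map_option fail_vars) U))))"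

text \<open>Number of free linear occurrences; a sharing variable and a \<open>fail\<close> annotation count.\<close>

primrec occ :: "var \<Rightarrow> trm \<Rightarrow> nat" where
  "occ x (Var y) = (if x = y then 1 else 0)"
| "occ x (UVar y i) = 0"
| "occ x (Lam y M) = (if x = y then 0 else occ x M)"
| "occ x (App M C U) = occ x M + \<Sum>\<^sub># (image_mset (occ x) C)
     + sum_list (map (case_option 0 id) (list_of (map_nelist (map_option (occ x)) U)))"
| "occ x (Fail X) = (if x \<in> fset X then 1 else 0)"
| "occ x (Share M ys y) = (if x \<in> set ys then 0 else occ x M) + (if x = y then 1 else 0)"
| "occ x (ISub M C U y) = (if x = y then 0 else occ x M) + \<Sum>\<^sub># (image_mset (occ x) C)
     + sum_list (map (case_option 0 id) (list_of (map_nelist (map_option (occ x)) U)))"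
| "occ x (LSub M C ys) = (if x \<in> set ys then 0 else occ x M) + \<Sum>\<^sub># (image_mset (occ x) C)"
| "occ x (USub M U y) = occ x M
     + sum_list (map (case_option 0 id) (list_of (map_nelist (map_option (occ x)) U)))"

text \<open>
  The syntactic conditions on terms. The requirements that a variable bound by an explicit
  substitution does not appear in another explicit substitution of the body are naming
  conventions that hold up to \<open>\<alpha>\<close>-equivalence, and are not imposed here: capture is excluded in
  the reduction rules instead.
\<close>

inductive lc_term :: "trm \<Rightarrow> bool" where
  "lc_term (Var x)"
| "lc_term (UVar x i)"
| "lc_term M \<Longrightarrow> lc_term (Lam x M)"
| "\<lbrakk>lc_term M; \<forall>N\<in>set_mset C. lc_term N; \<forall>N. Some N \<in> set (list_of U) \<longrightarrow> lc_term N\<rbrakk>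
    \<Longrightarrow> lc_term (App M C U)"
| "lc_term (Fail X)"
| "\<lbrakk>lc_term M; distinct xs; \<forall>y\<in>set xs. occ y M = 1 \<and> y \<notin> sharing_vars M\<rbrakk>
    \<Longrightarrow> lc_term (Share M xs x)"
| "\<lbrakk>lc_term M; \<forall>N\<in>set_mset C. lc_term N; \<forall>N. Some N \<in> set (list_of U) \<longrightarrow> lc_term N\<rbrakk>
    \<Longrightarrow> lc_term (ISub M C U x)"
| "\<lbrakk>lc_term M; \<forall>N\<in>set_mset C. lc_term N; distinct xs; size C = length xs;
     \<forall>y\<in>set xs. y \<in> lfv M \<and> y \<notin> sharing_vars M\<rbrakk>
    \<Longrightarrow> lc_term (LSub M C xs)"
| "\<lbrakk>lc_term M; \<forall>N. Some N \<in> set (list_of U) \<longrightarrow> lc_term N\<rbrakk> \<Longrightarrow> lc_term (USub M U x)"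


section \<open>Alpha-equivalence\<close>

text \<open>
  \<open>alpha ls us M N\<close> compares \<open>M\<close> and \<open>N\<close> below pairs of corresponding binders, innermost first:
  \<open>ls\<close> for binders of linear occurrences and \<open>us\<close> for binders of unrestricted occurrences.
\<close>

fun same_var :: "(var \<times> var) list \<Rightarrow> var \<Rightarrow> var \<Rightarrow> bool" where
  "same_var [] x y \<longleftrightarrow> x = y"
| "same_var ((a, b) # ps) x y \<longleftrightarrow> (if x = a \<or> y = b then x = a \<and> y = b else same_var ps x y)"

inductive alpha :: "(var \<times> var) list \<Rightarrow> (var \<times> var) list \<Rightarrow> trm \<Rightarrow> trm \<Rightarrow> bool" where
  "same_var ls x y \<Longrightarrow> alpha ls us (Var x) (Var y)"
| "same_var us x y \<Longrightarrow> alpha ls us (UVar x i) (UVar y i)"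
| "alpha ((x, y) # ls) ((x, y) # us) M N \<Longrightarrow> alpha ls us (Lam x M) (Lam y N)"
| "\<lbrakk>alpha ls us M N; rel_mset (alpha ls us) C D; rel_nelist (rel_option (alpha ls us)) U V\<rbrakk>
    \<Longrightarrow> alpha ls us (App M C U) (App N D V)"
| "rel_fset (same_var ls) X Y \<Longrightarrow> alpha ls us (Fail X) (Fail Y)"
| "\<lbrakk>length xs = length ys; distinct xs; distinct ys;
     alpha (zip xs ys @ ls) us M N; same_var ls x y\<rbrakk>
    \<Longrightarrow> alpha ls us (Share M xs x) (Share N ys y)"
| "\<lbrakk>alpha ((x, y) # ls) ((x, y) # us) M N; rel_mset (alpha ls us) C D;
     rel_nelist (rel_option (alpha ls us)) U V\<rbrakk>
    \<Longrightarrow> alpha ls us (ISub M C U x) (ISub N D V y)"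
| "\<lbrakk>length xs = length ys; distinct xs; distinct ys;
     alpha (zip xs ys @ ls) us M N; rel_mset (alpha ls us) C D\<rbrakk>
    \<Longrightarrow> alpha ls us (LSub M C xs) (LSub N D ys)"
| "\<lbrakk>alpha ls ((x, y) # us) M N; rel_nelist (rel_option (alpha ls us)) U V\<rbrakk>
    \<Longrightarrow> alpha ls us (USub M U x) (USub N V y)"
monos multiset.rel_mono_strong nelist.rel_mono_strong option.rel_mono_strong

abbreviation alpha_eq :: "trm \<Rightarrow> trm \<Rightarrow> bool" (infix \<open>\<approx>\<^sub>\<alpha>\<close> 50) where
  "M \<approx>\<^sub>\<alpha> N \<equiv> alpha [] [] M N"


section \<open>Reduction\<close>

primrec head :: "trm \<Rightarrow> trm" where
  "head (Var x) = Var x"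
| "head (UVar x i) = UVar x i"
| "head (Lam x M) = Lam x M"
| "head (App M C U) = head M"
| "head (Fail X) = Fail X"
| "head (Share M xs x) = (if \<exists>y\<in>set xs. head M = Var y then Var x else head M)"
| "head (ISub M C U x) = ISub M C U x"
| "head (LSub M C xs) = head M"
| "head (USub M U x) = head M"

text \<open>
  \<open>head_subst h N M\<close> replaces the head occurrence of the variable \<open>h\<close> (\<open>Var x\<close> or \<open>UVar x i\<close>) by
  \<open>N\<close>, without renaming. It is used only when \<open>h\<close> is the head of \<open>M\<close> and the binders that have
  the head in their scope, \<open>head_lbinders\<close> and \<open>head_ubinders\<close>, capture nothing.
\<close>

fun head_subst :: "trm \<Rightarrow> trm \<Rightarrow> trm \<Rightarrow> trm" where
  "head_subst h N (Var x) = (if h = Var x then N else Var x)"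
| "head_subst h N (UVar x i) = (if h = UVar x i then N else UVar x i)"
| "head_subst h N (Lam x M) = Lam x M"
| "head_subst h N (App M C U) = App (head_subst h N M) C U"
| "head_subst h N (Fail X) = Fail X"
| "head_subst h N (Share M xs x) = Share (head_subst h N M) xs x"
| "head_subst h N (ISub M C U x) = ISub M C U x"
| "head_subst h N (LSub M C xs) = LSub (head_subst h N M) C xs"
| "head_subst h N (USub M U x) = USub (head_subst h N M) U x"

primrec head_lbinders :: "trm \<Rightarrow> var set" where
  "head_lbinders (Var x) = {}"
| "head_lbinders (UVar x i) = {}"
| "head_lbinders (Lam x M) = {}"
| "head_lbinders (App M C U) = head_lbinders M"
| "head_lbinders (Fail X) = {}"
| "head_lbinders (Share M xs x) = head_lbinders M \<union> set xs"
| "head_lbinders (ISub M C U x) = {}"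
| "head_lbinders (LSub M C xs) = head_lbinders M \<union> set xs"
| "head_lbinders (USub M U x) = head_lbinders M"

primrec head_ubinders :: "trm \<Rightarrow> var set" where
  "head_ubinders (Var x) = {}"
| "head_ubinders (UVar x i) = {}"
| "head_ubinders (Lam x M) = {}"
| "head_ubinders (App M C U) = head_ubinders M"
| "head_ubinders (Fail X) = {}"
| "head_ubinders (Share M xs x) = head_ubinders M"
| "head_ubinders (ISub M C U x) = {}"
| "head_ubinders (LSub M C xs) = head_ubinders M"
| "head_ubinders (USub M U x) = head_ubinders M \<union> {x}"

datatype ctxt =
    Hole
  | CApp ctxt lbag ubag
  | CLSub ctxt lbag "var list"
  | CUSub ctxt ubag var
  | CShare ctxt "var list" var

primrec plug :: "ctxt \<Rightarrow> trm \<Rightarrow> trm" where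
  "plug Hole M = M"
| "plug (CApp E C U) M = App (plug E M) C U"
| "plug (CLSub E C xs) M = LSub (plug E M) C xs"
| "plug (CUSub E U x) M = USub (plug E M) U x"
| "plug (CShare E xs x) M = Share (plug E M) xs x"

text \<open>
  Terms are taken up to \<open>\<alpha>\<close>-equivalence, which is rule \<open>Alpha\<close>. The premises on disjointness and
  freshness express that no variable is captured; by \<open>Alpha\<close> they exclude no reduction.
  In \<open>Fetch_lin\<close> any element \<open>N\<close> of the bag may be fetched, and the head variable may be at any
  place of the sequence of variables to be substituted. In \<open>Cons2\<close> and \<open>Cons3\<close> the unions in the
  annotation of the redex are disjoint, since the variables \<open>xs\<close> are bound.
\<close>

inductive red :: "trm \<Rightarrow> trm \<Rightarrow> bool" (infix \<open>\<longlongrightarrow>\<^sub>C\<close> 50) where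
  Beta: "App (Lam x M) C U \<longlongrightarrow>\<^sub>C ISub M C U x"
| Ex_Sub: "\<lbrakk>size C = length xs; \<forall>Y. M \<noteq> Fail Y; x \<notin> ufv_lbag C\<rbrakk>
    \<Longrightarrow> ISub (Share M xs x) C U x \<longlongrightarrow>\<^sub>C USub (LSub M C xs) U x"
| Fetch_lin: "\<lbrakk>head M = Var y; N \<in># C; distinct (xs @ y # ys);
     head_lbinders M \<inter> (lfv N \<union> {y}) = {}; head_ubinders M \<inter> ufv N = {};
     set (xs @ ys) \<inter> lfv N = {}\<rbrakk>
    \<Longrightarrow> LSub M C (xs @ y # ys) \<longlongrightarrow>\<^sub>C LSub (head_subst (Var y) N M) (C - {#N#}) (xs @ ys)"
| Fail_lin: "\<lbrakk>size C \<noteq> length xs; fset Y = (lfv M - set xs) \<union> lfv_lbag C\<rbrakk>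
    \<Longrightarrow> ISub (Share M xs x) C U x \<longlongrightarrow>\<^sub>C Fail Y"
| Fetch_unr: "\<lbrakk>head M = UVar x i; ubag_at U i = Some N;
     head_lbinders M \<inter> lfv N = {}; head_ubinders M \<inter> (ufv N \<union> {x}) = {}; x \<notin> ufv N\<rbrakk>
    \<Longrightarrow> USub M U x \<longlongrightarrow>\<^sub>C USub (head_subst (UVar x i) N M) U x"
| Fail_unr: "\<lbrakk>head M = UVar x i; ubag_at U i = None; x \<notin> head_ubinders M\<rbrakk>
    \<Longrightarrow> USub M U x \<longlongrightarrow>\<^sub>C USub (head_subst (UVar x i) (Fail {||}) M) U x"
| Cons1: "fset Z = fset X \<union> lfv_lbag C \<Longrightarrow> App (Fail X) C U \<longlongrightarrow>\<^sub>C Fail Z"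
| Cons2: "\<lbrakk>size C = length xs; fset X = set xs \<union> fset Y; set xs \<inter> fset Y = {};
     fset Z = fset Y \<union> lfv_lbag C\<rbrakk>
    \<Longrightarrow> ISub (Share (Fail X) xs x) C U x \<longlongrightarrow>\<^sub>C Fail Z"
| Cons3: "\<lbrakk>fset X = fset Y \<union> set xs; fset Y \<inter> set xs = {}; fset Z = fset Y \<union> lfv_lbag C\<rbrakk>
    \<Longrightarrow> LSub (Fail X) C xs \<longlongrightarrow>\<^sub>C Fail Z"
| Cons4: "USub (Fail Y) U x \<longlongrightarrow>\<^sub>C Fail Y"
| TCont: "M \<longlongrightarrow>\<^sub>C N \<Longrightarrow> plug E M \<longlongrightarrow>\<^sub>C plug E N"
| Alpha: "\<lbrakk>M \<approx>\<^sub>\<alpha> M'; M' \<longlongrightarrow>\<^sub>C N'; N' \<approx>\<^sub>\<alpha> N\<rbrakk> \<Longrightarrow> M \<longlongrightarrow>\<^sub>C N"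


section \<open>Types and well-formedness\<close>

datatype sty =
    TUnit
  | TArr "sty multiset" "sty nelist" sty

text \<open>Multiset types: \<open>\<omega>\<close> is \<open>{#}\<close>, and a strict type \<open>\<sigma>\<close> is identified with \<open>{#\<sigma>#}\<close>.\<close>

type_synonym mty = "sty multiset"
type_synonym lty = "sty nelist"
type_synonym lctx = "var \<Rightarrow> mty option"
type_synonym uctx = "var \<Rightarrow> lty option"

abbreviation embraces :: "lty \<Rightarrow> lty \<Rightarrow> bool" (infix \<open>\<sim>\<close> 50) where
  "\<eta> \<sim> \<epsilon> \<equiv> prefix (list_of \<eta>) (list_of \<epsilon>)"

definition core :: "lctx \<Rightarrow> lctx" where
  "core \<Gamma> = (\<lambda>x. if \<Gamma> x = Some {#} then None else \<Gamma> x)"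

text \<open>\<open>add_vars \<Gamma> xs \<sigma>\<close> is the context \<open>\<Gamma>, x\<^sub>1 : \<sigma>, \<dots>, x\<^sub>k : \<sigma>\<close>.\<close>

definition add_vars :: "lctx \<Rightarrow> var list \<Rightarrow> sty \<Rightarrow> lctx" where
  "add_vars \<Gamma> xs \<sigma> = \<Gamma> ++ (\<lambda>y. if y \<in> set xs then Some {#\<sigma>#} else None)"

text \<open>
  A comma between linear contexts requires disjoint domains. An extension \<open>\<Theta>, x\<^sup>! : \<eta>\<close> of an
  unrestricted context at a binder is the update \<open>\<Theta>(x \<mapsto> \<eta>)\<close>, without \<open>x \<notin> dom \<Theta>\<close>: this makes
  the judgments apply to every representative of a term up to \<open>\<alpha>\<close>-equivalence, including those
  whose bound unrestricted variables are not fresh for \<open>\<Theta>\<close>.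
\<close>

inductive wf_trm :: "uctx \<Rightarrow> lctx \<Rightarrow> trm \<Rightarrow> sty \<Rightarrow> bool"
  and wf_lbag :: "uctx \<Rightarrow> lctx \<Rightarrow> lbag \<Rightarrow> mty \<Rightarrow> bool"
  and wf_ubag :: "uctx \<Rightarrow> lctx \<Rightarrow> ubag \<Rightarrow> lty \<Rightarrow> bool"
  and wf_bag :: "uctx \<Rightarrow> lctx \<Rightarrow> lbag \<times> ubag \<Rightarrow> mty \<times> lty \<Rightarrow> bool"
where
  var_lin: "wf_trm \<Theta> [x \<mapsto> {#\<sigma>#}] (Var x) \<sigma>"
| var_unr: "\<lbrakk>\<Theta> x = Some \<eta>; 1 \<le> i; i \<le> length (list_of \<eta>); x \<notin> dom \<Delta>;
     wf_trm \<Theta> (\<Delta>(x \<mapsto> {#list_of \<eta> ! (i - 1)#})) (Var x) \<sigma>\<rbrakk>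
    \<Longrightarrow> wf_trm \<Theta> \<Delta> (UVar x i) \<sigma>"
| one_lin: "wf_lbag \<Theta> Map.empty {#} {#}"
| bag_lin: "\<lbrakk>wf_trm \<Theta> \<Gamma> M \<sigma>; wf_lbag \<Theta> \<Delta> C (replicate_mset k \<sigma>); dom \<Gamma> \<inter> dom \<Delta> = {}\<rbrakk>
    \<Longrightarrow> wf_lbag \<Theta> (\<Gamma> ++ \<Delta>) (add_mset M C) (replicate_mset (k + 1) \<sigma>)"
| one_unr: "wf_ubag \<Theta> Map.empty (NE None []) (NE \<sigma> [])"
| single_unr: "wf_trm \<Theta> Map.empty M \<sigma> \<Longrightarrow> wf_ubag \<Theta> Map.empty (NE (Some M) []) (NE \<sigma> [])"
| bag_unr: "\<lbrakk>wf_ubag \<Theta> Map.empty U \<epsilon>; wf_ubag \<Theta> Map.empty V \<eta>\<rbrakk>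
    \<Longrightarrow> wf_ubag \<Theta> Map.empty (U \<diamondop> V) (\<epsilon> \<diamondop> \<eta>)"
| bag: "\<lbrakk>wf_lbag \<Theta> \<Gamma> C (replicate_mset k \<sigma>); wf_ubag \<Theta> Map.empty U \<eta>\<rbrakk>
    \<Longrightarrow> wf_bag \<Theta> \<Gamma> (C, U) (replicate_mset k \<sigma>, \<eta>)"
| fail: "dom (core \<Gamma>) = fset X \<Longrightarrow> wf_trm \<Theta> (core \<Gamma>) (Fail X) \<tau>"
| weak: "\<lbrakk>wf_trm \<Theta> \<Gamma> M \<tau>; x \<notin> dom \<Gamma>\<rbrakk> \<Longrightarrow> wf_trm \<Theta> (\<Gamma>(x \<mapsto> {#})) (Share M [] x) \<tau>"
| shar: "\<lbrakk>wf_trm \<Theta> (add_vars \<Gamma> xs \<sigma>) M \<tau>; distinct xs; set xs \<inter> dom \<Gamma> = {}; x \<notin> dom \<Gamma>;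
     length xs = k; k \<noteq> 0\<rbrakk>
    \<Longrightarrow> wf_trm \<Theta> (\<Gamma>(x \<mapsto> replicate_mset k \<sigma>)) (Share M xs x) \<tau>"
| abs_sh: "\<lbrakk>wf_trm (\<Theta>(x \<mapsto> \<eta>)) (\<Gamma>(x \<mapsto> replicate_mset k \<sigma>)) (Share M xs x) \<tau>; x \<notin> dom \<Gamma>\<rbrakk>
    \<Longrightarrow> wf_trm \<Theta> \<Gamma> (Lam x (Share M xs x)) (TArr (replicate_mset k \<sigma>) \<eta> \<tau>)"
| app: "\<lbrakk>wf_trm \<Theta> \<Gamma> M (TArr (replicate_mset j \<sigma>) \<eta> \<tau>); wf_bag \<Theta> \<Delta> (C, U) (replicate_mset k \<sigma>, \<epsilon>);
     \<eta> \<sim> \<epsilon>; dom \<Gamma> \<inter> dom \<Delta> = {}\<rbrakk>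
    \<Longrightarrow> wf_trm \<Theta> (\<Gamma> ++ \<Delta>) (App M C U) \<tau>"
| esub_unr: "\<lbrakk>wf_trm (\<Theta>(x \<mapsto> \<eta>)) \<Gamma> M \<tau>; wf_ubag \<Theta> Map.empty U \<epsilon>; \<eta> \<sim> \<epsilon>\<rbrakk>
    \<Longrightarrow> wf_trm \<Theta> \<Gamma> (USub M U x) \<tau>"
| esub: "\<lbrakk>wf_trm (\<Theta>(x \<mapsto> \<eta>)) (\<Gamma>(x \<mapsto> replicate_mset j \<sigma>)) (Share M xs x) \<tau>; x \<notin> dom \<Gamma>;
     wf_bag \<Theta> \<Delta> (C, U) (replicate_mset k \<sigma>, \<epsilon>); \<eta> \<sim> \<epsilon>; dom \<Gamma> \<inter> dom \<Delta> = {}\<rbrakk>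
    \<Longrightarrow> wf_trm \<Theta> (\<Gamma> ++ \<Delta>) (ISub (Share M xs x) C U x) \<tau>"
| esub_lin: "\<lbrakk>wf_trm \<Theta> (add_vars \<Gamma> xs \<sigma>) M \<tau>; distinct xs; set xs \<inter> dom \<Gamma> = {}; length xs = k;
     wf_lbag \<Theta> \<Delta> C (replicate_mset k \<sigma>); dom \<Gamma> \<inter> dom \<Delta> = {}\<rbrakk>
    \<Longrightarrow> wf_trm \<Theta> (\<Gamma> ++ \<Delta>) (LSub M C xs) \<tau>"

text \<open>
  Subject reduction fails for some failing reductions if the linear context assigns \<open>\<omega>\<close> to a variable: the
  weakened variable is free in the redex, so it is recorded in the resulting \<open>fail\<close>, but rule
  \<open>fail\<close> admits only contexts without \<open>\<omega>\<close>. Hence a premise on \<open>fail_vars\<close> is needed.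
\<close>

lemma subject_reduction_weakened_variable:
  fixes y z :: var
  assumes "y \<noteq> z"
  defines "M \<equiv> App (Fail {||}) {#Share (Var y) [] z#} (NE None [])"
    and "M' \<equiv> Fail {|y, z|}"
    and "\<Gamma> \<equiv> [y \<mapsto> {#TUnit#}, z \<mapsto> {#}]"
  shows "lc_term M" and "wf_trm Map.empty \<Gamma> M TUnit" and "M \<longlongrightarrow>\<^sub>C M'"
    and "\<not> wf_trm Map.empty \<Gamma> M' TUnit"
proof -
  show "lc_term M"
    unfolding M_def by (auto intro!: lc_term.intros)
  have 1: "wf_trm Map.empty Map.empty (Fail {||}) (TArr (replicate_mset 1 TUnit) (NE TUnit []) TUnit)"
    using fail[of Map.empty "{||}" Map.empty] by (simp add: core_def)
  have "wf_trm Map.empty ([y \<mapsto> {#TUnit#}](z \<mapsto> {#})) (Share (Var y) [] z) TUnit"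
    using assms(1) by (intro weak var_lin) auto
  then have "wf_lbag Map.empty (\<Gamma> ++ Map.empty) {#Share (Var y) [] z#} (replicate_mset (0 + 1) TUnit)"
    unfolding \<Gamma>_def by (intro bag_lin) (auto intro: one_lin)
  then have "wf_bag Map.empty \<Gamma> ({#Share (Var y) [] z#}, NE None []) (replicate_mset 1 TUnit, NE TUnit [])"
    by (intro bag one_unr) simp
  from app[OF 1 this] show "wf_trm Map.empty \<Gamma> M TUnit"
    unfolding M_def by simp
  show "M \<longlongrightarrow>\<^sub>C M'"
    unfolding M_def M'_def by (rule Cons1) auto
  show "\<not> wf_trm Map.empty \<Gamma> M' TUnit"
  proof
    assume "wf_trm Map.empty \<Gamma> M' TUnit"
    then obtain \<Gamma>' where "\<Gamma> = core \<Gamma>'"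
      unfolding M'_def by cases auto
    then have "core \<Gamma>' z = Some {#}"
      unfolding \<Gamma>_def using assms(1) by (metis fun_upd_same)
    then show False
      by (auto simp: core_def split: if_splits)
  qed
qed

end

(* A derivation determines its linear context: the domain of the context is the set of free linear
   variables of the term. So along an alpha-renaming the context can be transported variable by
   variable, and well-formedness is invariant under alpha-equivalence. Fetching is a substitution
   for the head, whose only occurrence is in the part of the context that the fetched term
   replaces. In the failing reductions the reduct records exactly the domain of the context, so
   rule fail applies as soon as no recorded variable has the empty type. *)

theory Submission
  imports Defs
begin

text \<open>Typability alone does not make fetching sound. In \<open>Share (Var z) [z] y\<close> the
  head is \<open>y\<close>, but only because \<open>y\<close> shares \<open>z\<close>, and
  \<open>head_subst\<close> finds nothing to replace; this is why the syntactic conditions on terms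
  enter. They constrain the redex, whereas the condition on recorded variables constrains the
  reduct. In the induction over reduction, both must descend through evaluation contexts to the hole
  and pass across alpha-equivalence, the first from the given redex to its renamed form, the second
  from the given reduct back to the renamed one. An evaluation context never enters a bag, an
  abstraction or an intermediate substitution, so both conditions are first weakened to the spine of
  the term, the positions that such a context can reach. The other obstacle is that binders are
  named. A renamed binder could a priori clash with the transported linear context. Such a clash is
  impossible because every variable of that context occurs free below the binder and must have a
  partner there.\<close>

section \<open>Bags\<close>

lemma list_of_map_nelist: "list_of (map_nelist f U) = map f (list_of U)"
  by (cases U) simp

lemma list_of_append: "list_of (U \<diamondop> V) = list_of U @ list_of V"
  by (cases U) simp

lemma rel_nelist_list_of: "rel_nelist R U V \<longleftrightarrow> list_all2 R (list_of U) (list_of V)"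
  by (cases U; cases V) simp

lemma Union_ubag:
  "\<Union> (\<Union> (set_option ` set (list_of (map_nelist (map_option f) U))))
     = (\<Union>N\<in>{N. Some N \<in> set (list_of U)}. f N)"
  by (force simp: list_of_map_nelist)

text \<open>Rule \<open>bag_unr\<close> may cut the list anywhere, so derivations have no canonical
  shape. The pointwise form forgets the bracketing; conversely a derivation is rebuilt by prepending
  one component at a time. An empty component \<open>None\<close> accepts every type.\<close>

lemma wf_ubag_iff:
  "wf_ubag \<Theta> \<Gamma> U \<epsilon> \<longleftrightarrow> \<Gamma> = Map.empty \<and>
     list_all2 (\<lambda>u \<sigma>. \<forall>M. u = Some M \<longrightarrow> wf_trm \<Theta> Map.empty M \<sigma>) (list_of U) (list_of \<epsilon>)"
  (is "_ \<longleftrightarrow> _ \<and> list_all2 ?P _ _")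
proof
  show "wf_ubag \<Theta> \<Gamma> U \<epsilon> \<Longrightarrow> \<Gamma> = Map.empty \<and> list_all2 ?P (list_of U) (list_of \<epsilon>)"
    by (induction rule: wf_trm_wf_lbag_wf_ubag_wf_bag.inducts(3)
          [where ?P1.0 = "\<lambda>_ _ _ _. True" and ?P2.0 = "\<lambda>_ _ _ _. True" and ?P4.0 = "\<lambda>_ _ _ _. True"])
      (auto simp: list_of_append intro: list_all2_appendI)
next
  have single: "wf_ubag \<Theta> Map.empty (NE u []) (NE \<sigma> [])" if "?P u \<sigma>" for u \<sigma>
    using that by (cases u) (auto intro: one_unr single_unr)
  have "wf_ubag \<Theta> Map.empty (NE u us) (NE \<sigma> \<sigma>s)" if "list_all2 ?P us \<sigma>s" "?P u \<sigma>" for u us \<sigma> \<sigma>s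
    using that
  proof (induction us \<sigma>s arbitrary: u \<sigma> rule: list_all2_induct)
    case Nil
    then show ?case by (rule single)
  next
    case (Cons v us \<rho> \<sigma>s)
    show ?case
      using bag_unr[OF single[OF Cons.prems] Cons.IH[OF Cons.hyps(1)]] by simp
  qed
  then show "\<Gamma> = Map.empty \<and> list_all2 ?P (list_of U) (list_of \<epsilon>) \<Longrightarrow> wf_ubag \<Theta> \<Gamma> U \<epsilon>"
    by (cases U; cases \<epsilon>) simp
qed

lemma wf_ubag_at:
  assumes "wf_ubag \<Theta> \<Gamma> U \<epsilon>" "ubag_at U i = Some N" "1 \<le> i" "i \<le> length (list_of \<epsilon>)"
  shows "wf_trm \<Theta> Map.empty N (list_of \<epsilon> ! (i - 1))"
  using assms by (auto simp: wf_ubag_iff ubag_at_def list_all2_conv_all_nth split: if_splits)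

lemma wf_lbag_empty_iff: "wf_lbag \<Theta> \<Gamma> {#} \<pi> \<longleftrightarrow> \<Gamma> = Map.empty \<and> \<pi> = {#}"
  by (auto intro: one_lin elim: wf_lbag.cases)

text \<open>A derivation adds the elements of a multiset in one particular order. Because contexts
  of different elements are disjoint, they commute, so any chosen element can be regarded as the one
  added last.\<close>

lemma wf_lbag_remove:
  assumes "wf_lbag \<Theta> \<Gamma> C \<pi>" "N \<in># C"
  shows "\<exists>\<Gamma>\<^sub>1 \<Gamma>\<^sub>2 \<sigma> k. \<Gamma> = \<Gamma>\<^sub>1 ++ \<Gamma>\<^sub>2 \<and> dom \<Gamma>\<^sub>1 \<inter> dom \<Gamma>\<^sub>2 = {} \<and> \<pi> = replicate_mset (k + 1) \<sigma> \<and>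
    wf_trm \<Theta> \<Gamma>\<^sub>1 N \<sigma> \<and> wf_lbag \<Theta> \<Gamma>\<^sub>2 (C - {#N#}) (replicate_mset k \<sigma>)"
  using assms
proof (induction rule: wf_trm_wf_lbag_wf_ubag_wf_bag.inducts(2)
    [where ?P1.0 = "\<lambda>_ _ _ _. True" and ?P3.0 = "\<lambda>_ _ _ _. True" and ?P4.0 = "\<lambda>_ _ _ _. True"])
  case (bag_lin \<Theta> \<Gamma> M \<sigma> \<Delta> C k)
  show ?case
  proof (cases "M = N")
    case True
    then show ?thesis
      using bag_lin.hyps by (intro exI[of _ \<Gamma>] exI[of _ \<Delta>] exI[of _ \<sigma>] exI[of _ k]) auto
  next
    case False
    with bag_lin.prems have "N \<in># C" by simp
    with bag_lin.IH obtain \<Gamma>\<^sub>1 \<Gamma>\<^sub>2 \<rho> l where *: "\<Delta> = \<Gamma>\<^sub>1 ++ \<Gamma>\<^sub>2" "dom \<Gamma>\<^sub>1 \<inter> dom \<Gamma>\<^sub>2 = {}"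
      "replicate_mset k \<sigma> = replicate_mset (l + 1) \<rho>" "wf_trm \<Theta> \<Gamma>\<^sub>1 N \<rho>"
      "wf_lbag \<Theta> \<Gamma>\<^sub>2 (C - {#N#}) (replicate_mset l \<rho>)"
      by blast
    have [simp]: "k = l + 1" using *(3) by (metis size_replicate_mset)
    have [simp]: "\<rho> = \<sigma>" using *(3) by (metis in_replicate_mset zero_less_Suc Suc_eq_plus1)
    have "wf_lbag \<Theta> (\<Gamma> ++ \<Gamma>\<^sub>2) (add_mset M (C - {#N#})) (replicate_mset (l + 1) \<sigma>)"
      using bag_lin.hyps * by (intro wf_trm_wf_lbag_wf_ubag_wf_bag.bag_lin) auto
    \<comment> \<open>The context of \<open>N\<close> is moved past that of \<open>M\<close>; the
      two have disjoint domains.\<close>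
    moreover have "\<Gamma> ++ \<Delta> = \<Gamma>\<^sub>1 ++ (\<Gamma> ++ \<Gamma>\<^sub>2)"
      using *(1) bag_lin.hyps map_add_comm[of \<Gamma> \<Gamma>\<^sub>1] by (simp add: Int_Un_distrib)
    moreover have "dom \<Gamma>\<^sub>1 \<inter> dom (\<Gamma> ++ \<Gamma>\<^sub>2) = {}"
      using *(1,2) bag_lin.hyps by auto
    ultimately show ?thesis
      using * \<open>N \<in># C\<close> False
      by (intro exI[of _ \<Gamma>\<^sub>1] exI[of _ "\<Gamma> ++ \<Gamma>\<^sub>2"] exI[of _ \<sigma>] exI[of _ "l + 1"]) auto
  qed
qed simp_all

lemma wf_lbag_size: "wf_lbag \<Theta> \<Gamma> C \<pi> \<Longrightarrow> size C = size \<pi>"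
  by (induction rule: wf_trm_wf_lbag_wf_ubag_wf_bag.inducts(2)
      [where ?P1.0 = "\<lambda>_ _ _ _. True" and ?P3.0 = "\<lambda>_ _ _ _. True" and ?P4.0 = "\<lambda>_ _ _ _. True"])
    auto


section \<open>Inversion of the well-formedness rules\<close>

lemma wf_Var_iff: "wf_trm \<Theta> \<Gamma> (Var x) \<tau> \<longleftrightarrow> \<Gamma> = [x \<mapsto> {#\<tau>#}]"
  by (auto intro: var_lin elim: wf_trm.cases)

text \<open>The auxiliary premise of \<open>var_unr\<close> types \<open>Var x\<close>, whose
  context is a singleton. Since \<open>x\<close> is not in the domain of \<open>\<Gamma>\<close>,
  nothing is left for \<open>\<Gamma>\<close>: an unrestricted occurrence consumes no linear
  resources.\<close>

lemma wf_UVar_iff: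
  "wf_trm \<Theta> \<Gamma> (UVar x i) \<tau> \<longleftrightarrow> \<Gamma> = Map.empty \<and>
     (\<exists>\<eta>. \<Theta> x = Some \<eta> \<and> 1 \<le> i \<and> i \<le> length (list_of \<eta>) \<and> \<tau> = list_of \<eta> ! (i - 1))"
proof
  assume "wf_trm \<Theta> \<Gamma> (UVar x i) \<tau>"
  then obtain \<eta> where *: "\<Theta> x = Some \<eta>" "1 \<le> i" "i \<le> length (list_of \<eta>)" "x \<notin> dom \<Gamma>"
      "\<Gamma>(x \<mapsto> {#list_of \<eta> ! (i - 1)#}) = [x \<mapsto> {#\<tau>#}]"
    by cases (auto simp: wf_Var_iff)
  have "\<Gamma> z = None" for z
    using *(4) fun_cong[OF *(5), of z] by (auto split: if_splits)
  with *(1-3) fun_cong[OF *(5), of x] show "\<Gamma> = Map.empty \<and>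
     (\<exists>\<eta>. \<Theta> x = Some \<eta> \<and> 1 \<le> i \<and> i \<le> length (list_of \<eta>) \<and> \<tau> = list_of \<eta> ! (i - 1))"
    by (auto simp del: One_nat_def)
qed (auto intro!: var_unr simp: wf_Var_iff)

text \<open>The contexts of the form \<open>core \<Gamma>\<close> are exactly those without an empty
  type, since such a context is its own core.\<close>

lemma wf_Fail_iff:
  "wf_trm \<Theta> \<Gamma> (Fail X) \<tau> \<longleftrightarrow> dom \<Gamma> = fset X \<and> (\<forall>z. \<Gamma> z \<noteq> Some {#})"
proof
  assume "wf_trm \<Theta> \<Gamma> (Fail X) \<tau>"
  then show "dom \<Gamma> = fset X \<and> (\<forall>z. \<Gamma> z \<noteq> Some {#})"
    by cases (auto simp: core_def split: if_splits)
next
  assume *: "dom \<Gamma> = fset X \<and> (\<forall>z. \<Gamma> z \<noteq> Some {#})"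
  then have "core \<Gamma> = \<Gamma>" by (auto simp: core_def)
  with * show "wf_trm \<Theta> \<Gamma> (Fail X) \<tau>" by (metis fail)
qed

lemma add_vars_Nil [simp]: "add_vars \<Gamma> [] \<sigma> = \<Gamma>"
  by (simp add: add_vars_def)

text \<open>Rules \<open>weak\<close> and \<open>shar\<close> merge into one: for an empty
  \<open>xs\<close> the multiset \<open>replicate_mset 0 \<sigma>\<close> is \<open>{#}\<close> and
  \<open>add_vars\<close> changes nothing, so \<open>\<sigma>\<close> is then arbitrary.\<close>

lemma wf_Share_iff:
  "wf_trm \<Theta> \<Gamma> (Share M xs x) \<tau> \<longleftrightarrow> distinct xs \<and>
     (\<exists>\<Delta> \<sigma>. \<Gamma> = \<Delta>(x \<mapsto> replicate_mset (length xs) \<sigma>) \<and> x \<notin> dom \<Delta> \<and> set xs \<inter> dom \<Delta> = {} \<and>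
       wf_trm \<Theta> (add_vars \<Delta> xs \<sigma>) M \<tau>)"
proof
  assume "wf_trm \<Theta> \<Gamma> (Share M xs x) \<tau>"
  then show "distinct xs \<and>
     (\<exists>\<Delta> \<sigma>. \<Gamma> = \<Delta>(x \<mapsto> replicate_mset (length xs) \<sigma>) \<and> x \<notin> dom \<Delta> \<and> set xs \<inter> dom \<Delta> = {} \<and>
       wf_trm \<Theta> (add_vars \<Delta> xs \<sigma>) M \<tau>)"
    by cases auto
qed (cases "xs = []"; auto intro: weak intro!: shar)

lemma wf_Lam_iff:
  "wf_trm \<Theta> \<Gamma> (Lam x M) \<rho> \<longleftrightarrow> (\<exists>L xs k \<sigma> \<eta> \<tau>. M = Share L xs x \<and>
     \<rho> = TArr (replicate_mset k \<sigma>) \<eta> \<tau> \<and> x \<notin> dom \<Gamma> \<and>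
     wf_trm (\<Theta>(x \<mapsto> \<eta>)) (\<Gamma>(x \<mapsto> replicate_mset k \<sigma>)) M \<tau>)"
proof
  assume "wf_trm \<Theta> \<Gamma> (Lam x M) \<rho>"
  then show "\<exists>L xs k \<sigma> \<eta> \<tau>. M = Share L xs x \<and> \<rho> = TArr (replicate_mset k \<sigma>) \<eta> \<tau> \<and> x \<notin> dom \<Gamma> \<and>
     wf_trm (\<Theta>(x \<mapsto> \<eta>)) (\<Gamma>(x \<mapsto> replicate_mset k \<sigma>)) M \<tau>"
    by cases blast
qed (auto intro: abs_sh)

lemma wf_bag_iff:
  "wf_bag \<Theta> \<Gamma> (C, U) (\<pi>, \<epsilon>) \<longleftrightarrow>
     (\<exists>k \<sigma>. \<pi> = replicate_mset k \<sigma>) \<and> wf_lbag \<Theta> \<Gamma> C \<pi> \<and> wf_ubag \<Theta> Map.empty U \<epsilon>"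
  by (auto intro: bag elim!: wf_bag.cases)

lemma wf_App_iff:
  "wf_trm \<Theta> \<Gamma> (App M C U) \<tau> \<longleftrightarrow> (\<exists>\<Gamma>\<^sub>1 \<Gamma>\<^sub>2 j k \<sigma> \<eta> \<epsilon>. \<Gamma> = \<Gamma>\<^sub>1 ++ \<Gamma>\<^sub>2 \<and> dom \<Gamma>\<^sub>1 \<inter> dom \<Gamma>\<^sub>2 = {} \<and> \<eta> \<sim> \<epsilon> \<and>
     wf_trm \<Theta> \<Gamma>\<^sub>1 M (TArr (replicate_mset j \<sigma>) \<eta> \<tau>) \<and>
     wf_lbag \<Theta> \<Gamma>\<^sub>2 C (replicate_mset k \<sigma>) \<and> wf_ubag \<Theta> Map.empty U \<epsilon>)" (is "_ \<longleftrightarrow> ?R")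
proof
  assume "wf_trm \<Theta> \<Gamma> (App M C U) \<tau>"
  then show ?R by cases (unfold wf_bag_iff, blast)
next
  assume ?R
  then show "wf_trm \<Theta> \<Gamma> (App M C U) \<tau>" by (blast intro: app bag)
qed

lemma wf_USub_iff:
  "wf_trm \<Theta> \<Gamma> (USub M U x) \<tau> \<longleftrightarrow>
     (\<exists>\<eta> \<epsilon>. \<eta> \<sim> \<epsilon> \<and> wf_trm (\<Theta>(x \<mapsto> \<eta>)) \<Gamma> M \<tau> \<and> wf_ubag \<Theta> Map.empty U \<epsilon>)" (is "_ \<longleftrightarrow> ?R")
proof
  assume "wf_trm \<Theta> \<Gamma> (USub M U x) \<tau>"
  then show ?R by cases blast
qed (auto intro: esub_unr)

lemma wf_ISub_iff:
  "wf_trm \<Theta> \<Gamma> (ISub M C U x) \<tau> \<longleftrightarrow> (\<exists>L xs \<Gamma>\<^sub>1 \<Gamma>\<^sub>2 j k \<sigma> \<eta> \<epsilon>. M = Share L xs x \<and>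
     \<Gamma> = \<Gamma>\<^sub>1 ++ \<Gamma>\<^sub>2 \<and> dom \<Gamma>\<^sub>1 \<inter> dom \<Gamma>\<^sub>2 = {} \<and> \<eta> \<sim> \<epsilon> \<and> x \<notin> dom \<Gamma>\<^sub>1 \<and>
     wf_trm (\<Theta>(x \<mapsto> \<eta>)) (\<Gamma>\<^sub>1(x \<mapsto> replicate_mset j \<sigma>)) M \<tau> \<and>
     wf_lbag \<Theta> \<Gamma>\<^sub>2 C (replicate_mset k \<sigma>) \<and> wf_ubag \<Theta> Map.empty U \<epsilon>)" (is "_ \<longleftrightarrow> ?R")
proof
  assume "wf_trm \<Theta> \<Gamma> (ISub M C U x) \<tau>"
  then show ?R by cases (unfold wf_bag_iff, blast)
next
  assume ?R
  then show "wf_trm \<Theta> \<Gamma> (ISub M C U x) \<tau>" by (blast intro: esub bag)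
qed

lemma wf_LSub_iff:
  "wf_trm \<Theta> \<Gamma> (LSub M C xs) \<tau> \<longleftrightarrow> distinct xs \<and> (\<exists>\<Gamma>\<^sub>1 \<Gamma>\<^sub>2 \<sigma>. \<Gamma> = \<Gamma>\<^sub>1 ++ \<Gamma>\<^sub>2 \<and>
     dom \<Gamma>\<^sub>1 \<inter> dom \<Gamma>\<^sub>2 = {} \<and> set xs \<inter> dom \<Gamma>\<^sub>1 = {} \<and> wf_trm \<Theta> (add_vars \<Gamma>\<^sub>1 xs \<sigma>) M \<tau> \<and>
     wf_lbag \<Theta> \<Gamma>\<^sub>2 C (replicate_mset (length xs) \<sigma>))" (is "_ \<longleftrightarrow> ?R")
proof
  assume "wf_trm \<Theta> \<Gamma> (LSub M C xs) \<tau>"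
  then show ?R by cases blast
qed (auto intro: esub_lin)


section \<open>Contexts and free variables\<close>

lemma dom_add_vars [simp]: "dom (add_vars \<Gamma> xs \<sigma>) = dom \<Gamma> \<union> set xs"
  by (auto simp: add_vars_def)

lemma dom_fun_upd_Some_eqD: "dom (\<Gamma>(x \<mapsto> v)) = A \<Longrightarrow> x \<notin> dom \<Gamma> \<Longrightarrow> dom \<Gamma> = A - {x}"
  by auto

lemma wf_trm_dom: "wf_trm \<Theta> \<Gamma> M \<tau> \<Longrightarrow> dom \<Gamma> = lfv M"
  and wf_lbag_dom: "wf_lbag \<Theta> \<Gamma> C \<pi> \<Longrightarrow> dom \<Gamma> = lfv_lbag C"
  and wf_ubag_lfv: "wf_ubag \<Theta> \<Gamma> U \<epsilon> \<Longrightarrow> (\<Union>N\<in>{N. Some N \<in> set (list_of U)}. lfv N) = {}"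
  and wf_bag_dom: "wf_bag \<Theta> \<Gamma> B \<xi> \<Longrightarrow> dom \<Gamma> = lfv_lbag (fst B) \<and>
    (\<Union>N\<in>{N. Some N \<in> set (list_of (snd B))}. lfv N) = {}"
proof (induction rule: wf_trm_wf_lbag_wf_ubag_wf_bag.inducts)
  case (var_unr \<Theta> x \<eta> i \<Delta> \<sigma>)
  \<comment> \<open>The premise about \<open>Var x\<close> speaks of an extended context, so its
    induction hypothesis says nothing direct about \<open>\<Delta>\<close>. The conclusion is
    rebuilt and inverted instead.\<close>
  then have "wf_trm \<Theta> \<Delta> (UVar x i) \<sigma>" by (intro wf_trm_wf_lbag_wf_ubag_wf_bag.var_unr)
  then show ?case by (simp add: wf_UVar_iff)
next
  case (shar \<Theta> \<Gamma> xs \<sigma> M \<tau> x k)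
  then have "dom \<Gamma> = lfv M - set xs" by (auto simp del: domIff)
  then show ?case unfolding dom_fun_upd by simp
next
  case (weak \<Theta> \<Gamma> M \<tau> x)
  then show ?case unfolding dom_fun_upd by simp
next
  case (abs_sh \<Theta> x \<eta> \<Gamma> k \<sigma> M xs \<tau>)
  then have "dom \<Gamma> = lfv (Share M xs x) - {x}" by (intro dom_fun_upd_Some_eqD)
  then show ?case by simp
next
  case (esub \<Theta> x \<eta> \<Gamma> j \<sigma> M xs \<tau> \<Delta> C U k \<epsilon>)
  then have "dom \<Gamma> = lfv (Share M xs x) - {x}" by (intro dom_fun_upd_Some_eqD)
  with esub.IH(2) show ?case by (simp add: Union_ubag Un_ac del: lfv.simps(6))
next
  case (esub_lin \<Theta> \<Gamma> xs \<sigma> M \<tau> k \<Delta> C)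
  then have "dom \<Gamma> = lfv M - set xs" by (auto simp del: domIff)
  with esub_lin.IH(2) show ?case by (simp add: Un_ac)
qed (auto simp: Union_ubag list_of_append split: if_splits)

text \<open>This is weakening, strengthening and shadowing at once, the form suited to binders that
  update \<open>\<Theta>\<close>. It is what allows a bag or a fetched term to move below a binder
  of \<open>x[i]\<close> when \<open>x\<close> is not among its free unrestricted names.\<close>

lemma wf_trm_cong_uctx:
    "wf_trm \<Theta> \<Gamma> M \<tau> \<Longrightarrow> (\<And>x. x \<in> ufv M \<Longrightarrow> \<Theta>' x = \<Theta> x) \<Longrightarrow> wf_trm \<Theta>' \<Gamma> M \<tau>"
  and wf_lbag_cong_uctx:
    "wf_lbag \<Theta> \<Gamma> C \<pi> \<Longrightarrow> (\<And>x. x \<in> ufv_lbag C \<Longrightarrow> \<Theta>' x = \<Theta> x) \<Longrightarrow> wf_lbag \<Theta>' \<Gamma> C \<pi>"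
  and wf_ubag_cong_uctx:
    "wf_ubag \<Theta> \<Gamma> U \<epsilon> \<Longrightarrow> (\<And>x N. Some N \<in> set (list_of U) \<Longrightarrow> x \<in> ufv N \<Longrightarrow> \<Theta>' x = \<Theta> x)
       \<Longrightarrow> wf_ubag \<Theta>' \<Gamma> U \<epsilon>"
  and wf_bag_cong_uctx:
    "wf_bag \<Theta> \<Gamma> B \<xi> \<Longrightarrow> (\<And>x. x \<in> ufv_lbag (fst B) \<Longrightarrow> \<Theta>' x = \<Theta> x)
       \<Longrightarrow> (\<And>x N. Some N \<in> set (list_of (snd B)) \<Longrightarrow> x \<in> ufv N \<Longrightarrow> \<Theta>' x = \<Theta> x)
       \<Longrightarrow> wf_bag \<Theta>' \<Gamma> B \<xi>"
proof (induction arbitrary: \<Theta>' and \<Theta>' and \<Theta>' and \<Theta>' rule: wf_trm_wf_lbag_wf_ubag_wf_bag.inducts)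
  case (var_unr \<Theta> x \<eta> i \<Delta> \<sigma>)
  then show ?case by (auto simp: wf_Var_iff intro!: wf_trm_wf_lbag_wf_ubag_wf_bag.var_unr)
next
  case (abs_sh \<Theta> x \<eta> \<Gamma> k \<sigma> M xs \<tau>)
  have "wf_trm (\<Theta>'(x \<mapsto> \<eta>)) (\<Gamma>(x \<mapsto> replicate_mset k \<sigma>)) (Share M xs x) \<tau>"
    using abs_sh.prems by (intro abs_sh.IH) auto
  with abs_sh.hyps show ?case by (intro wf_trm_wf_lbag_wf_ubag_wf_bag.abs_sh)
next
  case (esub_unr \<Theta> x \<eta> \<Gamma> M \<tau> U \<epsilon>)
  have "wf_trm (\<Theta>'(x \<mapsto> \<eta>)) \<Gamma> M \<tau>" "wf_ubag \<Theta>' Map.empty U \<epsilon>"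
    using esub_unr.prems unfolding ufv.simps Union_ubag by (intro esub_unr.IH; force)+
  with esub_unr.hyps show ?case by (intro wf_trm_wf_lbag_wf_ubag_wf_bag.esub_unr)
next
  case (esub \<Theta> x \<eta> \<Gamma> j \<sigma> M xs \<tau> \<Delta> C U k \<epsilon>)
  have "wf_trm (\<Theta>'(x \<mapsto> \<eta>)) (\<Gamma>(x \<mapsto> replicate_mset j \<sigma>)) (Share M xs x) \<tau>"
    "wf_bag \<Theta>' \<Delta> (C, U) (replicate_mset k \<sigma>, \<epsilon>)"
    using esub.prems unfolding ufv.simps Union_ubag by (intro esub.IH; force)+
  with esub.hyps show ?case by (intro wf_trm_wf_lbag_wf_ubag_wf_bag.esub)
next
  case (app \<Theta> \<Gamma> M j \<sigma> \<eta> \<tau> \<Delta> C U k \<epsilon>)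
  have "wf_trm \<Theta>' \<Gamma> M (TArr (replicate_mset j \<sigma>) \<eta> \<tau>)"
    "wf_bag \<Theta>' \<Delta> (C, U) (replicate_mset k \<sigma>, \<epsilon>)"
    using app.prems unfolding ufv.simps Union_ubag by (intro app.IH; force)+
  with app.hyps show ?case by (intro wf_trm_wf_lbag_wf_ubag_wf_bag.app)
next
  case (bag_unr \<Theta> U \<epsilon> V \<eta>)
  then show ?case by (auto simp: list_of_append intro!: wf_trm_wf_lbag_wf_ubag_wf_bag.bag_unr)
next
  case (bag_lin \<Theta> \<Gamma> M \<sigma> \<Delta> C k)
  have "wf_trm \<Theta>' \<Gamma> M \<sigma>" "wf_lbag \<Theta>' \<Delta> C (replicate_mset k \<sigma>)"
    using bag_lin.prems by (intro bag_lin.IH; force)+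
  with bag_lin.hyps show ?case by (intro wf_trm_wf_lbag_wf_ubag_wf_bag.bag_lin)
next
  case (esub_lin \<Theta> \<Gamma> xs \<sigma> M \<tau> k \<Delta> C)
  have "wf_trm \<Theta>' (add_vars \<Gamma> xs \<sigma>) M \<tau>" "wf_lbag \<Theta>' \<Delta> C (replicate_mset k \<sigma>)"
    using esub_lin.prems by (intro esub_lin.IH; force)+
  with esub_lin.hyps show ?case by (intro wf_trm_wf_lbag_wf_ubag_wf_bag.esub_lin)
qed (auto intro: wf_trm_wf_lbag_wf_ubag_wf_bag.intros)


section \<open>Alpha-equivalence\<close>

lemma same_var_Cons:
  "same_var (p # ls) x y \<longleftrightarrow>
     x = fst p \<and> y = snd p \<or> x \<noteq> fst p \<and> y \<noteq> snd p \<and> same_var ls x y"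
  by (cases p) auto

text \<open>A name captured by the innermost binder on one side only has no partner, so matching is
  a partial bijection between names.\<close>

lemma same_var_unique:
  "same_var ls x y \<Longrightarrow> same_var ls x y' \<Longrightarrow> y = y'"
  "same_var ls x y \<Longrightarrow> same_var ls x' y \<Longrightarrow> x = x'"
  by (induction ls) (auto simp del: same_var.simps(2) simp: same_var_Cons)

lemma same_var_Nil: "same_var [] = (=)"
  by (auto simp: fun_eq_iff)

text \<open>The names within one block of binders are distinct on each side, so no pair shadows
  another and the lookup becomes order-free membership.\<close>

lemma same_var_zip:
  assumes "length xs = length ys" "distinct xs" "distinct ys"
  shows "same_var (zip xs ys @ ls) x y \<longleftrightarrow>
    (x, y) \<in> set (zip xs ys) \<or> x \<notin> set xs \<and> y \<notin> set ys \<and> same_var ls x y"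
  using assms
  by (induction xs ys rule: list_induct2) (auto dest: set_zip_leftD set_zip_rightD)

lemma rel_set_same_var_diff:
  assumes "rel_set (same_var (zip xs ys @ ls)) A B"
    and "length xs = length ys" "distinct xs" "distinct ys"
  shows "rel_set (same_var ls) (A - set xs) (B - set ys)"
proof (rule rel_setI)
  fix x assume x: "x \<in> A - set xs"
  with assms(1) obtain y where y: "y \<in> B" "same_var (zip xs ys @ ls) x y"
    by (auto dest: rel_setD1)
  with x show "\<exists>y\<in>B - set ys. same_var ls x y"
    unfolding same_var_zip[OF assms(2-4)] by (auto dest: set_zip_leftD)
next
  fix y assume y: "y \<in> B - set ys"
  with assms(1) obtain x where x: "x \<in> A" "same_var (zip xs ys @ ls) x y"
    by (auto dest: rel_setD2)
  with y show "\<exists>x\<in>A - set xs. same_var ls x y"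
    unfolding same_var_zip[OF assms(2-4)] by (auto dest: set_zip_rightD)
qed

lemma rel_set_same_var_diff1:
  assumes "rel_set (same_var ((x, y) # ls)) A B"
  shows "rel_set (same_var ls) (A - {x}) (B - {y})"
  using rel_set_same_var_diff[of "[x]" "[y]" ls A B] assms by simp

lemma rel_set_Un: "rel_set R A B \<Longrightarrow> rel_set R A' B' \<Longrightarrow> rel_set R (A \<union> A') (B \<union> B')"
  by (auto simp: rel_set_def)

lemma rel_set_insert: "R a b \<Longrightarrow> rel_set R A B \<Longrightarrow> rel_set R (insert a A) (insert b B)"
  by (auto simp: rel_set_def)

lemma rel_set_UN_list:
  assumes "list_all2 Q as bs" "\<And>a b. Q a b \<Longrightarrow> rel_set R (f a) (g b)"
  shows "rel_set R (\<Union>a\<in>set as. f a) (\<Union>b\<in>set bs. g b)"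
  using assms(1) by (induction rule: list_all2_induct) (auto intro!: rel_set_Un assms(2) empty_transfer)

lemma rel_set_UN_lbag:
  assumes "rel_mset Q C D" "\<And>M N. Q M N \<Longrightarrow> rel_set R (f M) (g N)"
  shows "rel_set R (\<Union>M\<in>set_mset C. f M) (\<Union>N\<in>set_mset D. g N)"
  using assms rel_set_UN_list[of Q _ _ R f g] by (auto simp: rel_mset_def)

lemma UN_Some: "(\<Union>M\<in>{M. Some M \<in> A}. f M) = (\<Union>u\<in>A. \<Union>M\<in>set_option u. f M)"
  by force

lemma rel_set_UN_ubag:
  assumes "rel_nelist (rel_option Q) U V" "\<And>M N. Q M N \<Longrightarrow> rel_set R (f M) (g N)"
  shows "rel_set R (\<Union>M\<in>{M. Some M \<in> set (list_of U)}. f M)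
                   (\<Union>N\<in>{N. Some N \<in> set (list_of V)}. g N)"
  unfolding UN_Some using assms
  by (intro rel_set_UN_list[of "rel_option Q"])
    (auto simp: rel_nelist_list_of empty_transfer elim: option.rel_cases)

text \<open>The sets are related and not equal, because names below the binders differ. Applied to
  the body of a binder, it supplies every free variable with a partner below that binder.\<close>

lemma alpha_lfv: "alpha ls us M N \<Longrightarrow> rel_set (same_var ls) (lfv M) (lfv N)"
proof (induction rule: alpha.induct)
  case (5 ls X Y us)
  then show ?case by (simp add: rel_fset.rep_eq)
qed (auto simp: Union_ubag simp del: same_var.simps
      intro!: empty_transfer rel_set_Un rel_set_insert rel_set_UN_lbag rel_set_UN_ubag rel_set_same_var_diff rel_set_same_var_diff1)

section \<open>Transport of linear contexts along a renaming\<close>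

text \<open>Since \<open>same_var ls\<close> is a partial bijection, the two inclusions together say
  that \<open>\<Gamma>'\<close> is precisely \<open>\<Gamma>\<close> renamed along
  \<open>ls\<close>, with the types kept.\<close>

definition ctx_rel :: "(var \<times> var) list \<Rightarrow> lctx \<Rightarrow> lctx \<Rightarrow> bool" where
  "ctx_rel ls \<Gamma> \<Gamma>' \<longleftrightarrow>
     (\<forall>x v. \<Gamma> x = Some v \<longrightarrow> (\<exists>y. same_var ls x y \<and> \<Gamma>' y = Some v)) \<and>
     (\<forall>y v. \<Gamma>' y = Some v \<longrightarrow> (\<exists>x. same_var ls x y \<and> \<Gamma> x = Some v))"

lemma ctx_rel_refl: "ctx_rel [] \<Gamma> \<Gamma>"
  by (simp add: ctx_rel_def)

lemma ctx_rel_empty [simp]: "ctx_rel ls Map.empty \<Gamma>' \<longleftrightarrow> \<Gamma>' = Map.empty"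
  by (auto simp: ctx_rel_def fun_eq_iff)

lemma ctx_rel_dom: "ctx_rel ls \<Gamma> \<Gamma>' \<Longrightarrow> rel_set (same_var ls) (dom \<Gamma>) (dom \<Gamma>')"
  by (fastforce simp: ctx_rel_def rel_set_def dom_def)

text \<open>Each half of \<open>\<Gamma>'\<close> is its restriction to the image of the
  corresponding domain. The images cover \<open>\<Gamma>'\<close> and are disjoint because matching
  is injective.\<close>

lemma ctx_rel_add:
  assumes "ctx_rel ls (\<Gamma>\<^sub>1 ++ \<Gamma>\<^sub>2) \<Gamma>'" "dom \<Gamma>\<^sub>1 \<inter> dom \<Gamma>\<^sub>2 = {}"
  obtains \<Gamma>\<^sub>1' \<Gamma>\<^sub>2' where "\<Gamma>' = \<Gamma>\<^sub>1' ++ \<Gamma>\<^sub>2'" "dom \<Gamma>\<^sub>1' \<inter> dom \<Gamma>\<^sub>2' = {}"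
    "ctx_rel ls \<Gamma>\<^sub>1 \<Gamma>\<^sub>1'" "ctx_rel ls \<Gamma>\<^sub>2 \<Gamma>\<^sub>2'"
proof
  define A where "A \<Gamma> = {y. \<exists>x\<in>dom \<Gamma>. same_var ls x y}" for \<Gamma> :: lctx
  have cover: "dom \<Gamma>' \<subseteq> A \<Gamma>\<^sub>1 \<union> A \<Gamma>\<^sub>2"
    using rel_setD2[OF ctx_rel_dom[OF assms(1)]] by (fastforce simp: A_def)
  have disjoint: "A \<Gamma>\<^sub>1 \<inter> A \<Gamma>\<^sub>2 = {}"
    using assms(2) by (auto simp: A_def dest: same_var_unique(2))
  show "\<Gamma>' = \<Gamma>' |` A \<Gamma>\<^sub>1 ++ \<Gamma>' |` A \<Gamma>\<^sub>2"
    using cover by (auto simp: fun_eq_iff map_add_def restrict_map_def dom_def split: option.splits)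
  show "dom (\<Gamma>' |` A \<Gamma>\<^sub>1) \<inter> dom (\<Gamma>' |` A \<Gamma>\<^sub>2) = {}"
    using disjoint by auto
  \<comment> \<open>The assumption on \<open>\<Delta>\<close> holds for both summands, for the left
    one by disjointness.\<close>
  have part: "ctx_rel ls \<Delta> (\<Gamma>' |` A \<Delta>)" if "\<And>x. x \<in> dom \<Delta> \<Longrightarrow> (\<Gamma>\<^sub>1 ++ \<Gamma>\<^sub>2) x = \<Delta> x" for \<Delta>
    unfolding ctx_rel_def
  proof (intro conjI allI impI)
    fix x v assume x: "\<Delta> x = Some v"
    with that[of x] have "(\<Gamma>\<^sub>1 ++ \<Gamma>\<^sub>2) x = Some v" by auto
    with assms(1) obtain y where "same_var ls x y" "\<Gamma>' y = Some v"
      unfolding ctx_rel_def by metis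
    with x show "\<exists>y. same_var ls x y \<and> (\<Gamma>' |` A \<Delta>) y = Some v"
      by (auto simp: A_def restrict_map_def)
  next
    fix y v assume "(\<Gamma>' |` A \<Delta>) y = Some v"
    then obtain x where x: "x \<in> dom \<Delta>" "same_var ls x y" "\<Gamma>' y = Some v"
      by (auto simp: A_def restrict_map_def split: if_splits)
    with assms(1) obtain x' where "same_var ls x' y" "(\<Gamma>\<^sub>1 ++ \<Gamma>\<^sub>2) x' = Some v"
      unfolding ctx_rel_def by metis
    with x that[of x] show "\<exists>x. same_var ls x y \<and> \<Delta> x = Some v"
      using same_var_unique(2) by metis
  qed
  show "ctx_rel ls \<Gamma>\<^sub>1 (\<Gamma>' |` A \<Gamma>\<^sub>1)" "ctx_rel ls \<Gamma>\<^sub>2 (\<Gamma>' |` A \<Gamma>\<^sub>2)"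
    using assms(2) by (auto intro!: part simp: map_add_dom_app_simps map_add_def split: option.splits)
qed

lemma ctx_rel_single:
  assumes "ctx_rel ls [x \<mapsto> v] \<Gamma>'" "same_var ls x y"
  shows "\<Gamma>' = [y \<mapsto> v]"
proof
  fix z
  have "\<exists>w. same_var ls x w \<and> \<Gamma>' w = Some v"
    using assms(1) by (simp add: ctx_rel_def)
  then have "\<Gamma>' y = Some v"
    using assms(2) by (auto dest: same_var_unique(1))
  moreover have "\<Gamma>' z = None" if "z \<noteq> y"
  proof (rule ccontr)
    assume "\<Gamma>' z \<noteq> None"
    with assms(1) have "same_var ls x z" by (auto simp: ctx_rel_def split: if_splits)
    with assms(2) that show False by (auto dest: same_var_unique(1))
  qed
  ultimately show "\<Gamma>' z = [y \<mapsto> v] z" by simp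
qed

lemma ctx_rel_upd:
  assumes "ctx_rel ls (\<Gamma>(x \<mapsto> v)) \<Gamma>'" "same_var ls x y" "x \<notin> dom \<Gamma>"
  obtains \<Delta> where "\<Gamma>' = \<Delta>(y \<mapsto> v)" "y \<notin> dom \<Delta>" "ctx_rel ls \<Gamma> \<Delta>"
proof -
  have "ctx_rel ls (\<Gamma> ++ [x \<mapsto> v]) \<Gamma>'" "dom \<Gamma> \<inter> dom [x \<mapsto> v] = {}"
    using assms by auto
  then obtain \<Delta> \<Delta>' where *: "\<Gamma>' = \<Delta> ++ \<Delta>'" "dom \<Delta> \<inter> dom \<Delta>' = {}"
    "ctx_rel ls \<Gamma> \<Delta>" "ctx_rel ls [x \<mapsto> v] \<Delta>'"
    by (rule ctx_rel_add)
  have "\<Delta>' = [y \<mapsto> v]"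
    using *(4) assms(2) by (rule ctx_rel_single)
  with * that[of \<Delta>] show thesis by auto
qed

text \<open>\<open>A\<close> stands for the free variables of the body. If some \<open>y\<close> in
  \<open>ys\<close> lay in \<open>dom \<Gamma>'\<close>, its partner \<open>x\<close> in
  \<open>dom \<Gamma>\<close> would be in \<open>A\<close> and so have a partner below the new
  binders. As \<open>x\<close> is not in \<open>xs\<close>, that partner lies outside
  \<open>ys\<close> and matches \<open>x\<close> along \<open>ls\<close> as well, hence equals
  \<open>y\<close>, a contradiction. The common type \<open>v\<close> covers both
  \<open>add_vars\<close> and a single update.\<close>

lemma ctx_rel_binder:
  assumes "ctx_rel ls \<Gamma> \<Gamma>'" "rel_set (same_var (zip xs ys @ ls)) A B"
    and "dom \<Gamma> \<subseteq> A" "set xs \<inter> dom \<Gamma> = {}"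
    and "length xs = length ys" "distinct xs" "distinct ys"
  shows "set ys \<inter> dom \<Gamma>' = {}"
    and "ctx_rel (zip xs ys @ ls) (\<Gamma> ++ (\<lambda>z. if z \<in> set xs then Some v else None))
      (\<Gamma>' ++ (\<lambda>z. if z \<in> set ys then Some v else None))"
proof -
  note sv = same_var_zip[OF assms(5-7)]
  show fresh: "set ys \<inter> dom \<Gamma>' = {}"
  proof (rule ccontr)
    assume "set ys \<inter> dom \<Gamma>' \<noteq> {}"
    then obtain y where y: "y \<in> set ys" "y \<in> dom \<Gamma>'" by auto
    then obtain x where x: "x \<in> dom \<Gamma>" "same_var ls x y"
      using rel_setD2[OF ctx_rel_dom[OF assms(1)]] by blast
    with assms(2,3) obtain z where z: "same_var (zip xs ys @ ls) x z"
      by (meson rel_setD1 subsetD)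
    have "x \<notin> set xs" using x(1) assms(4) by auto
    with z have "z \<notin> set ys" "same_var ls x z"
      unfolding sv by (auto dest: set_zip_leftD)
    with x(2) y(1) show False by (auto dest: same_var_unique(1))
  qed
  have ex: "x \<in> set xs \<Longrightarrow> \<exists>y. (x, y) \<in> set (zip xs ys)"
    "y \<in> set ys \<Longrightarrow> \<exists>x. (x, y) \<in> set (zip xs ys)" for x y
    using assms(5) by (metis in_set_impl_in_set_zip1, metis in_set_impl_in_set_zip2)
  show "ctx_rel (zip xs ys @ ls) (\<Gamma> ++ (\<lambda>z. if z \<in> set xs then Some v else None))
      (\<Gamma>' ++ (\<lambda>z. if z \<in> set ys then Some v else None))"
    unfolding ctx_rel_def
  proof (intro conjI allI impI)
    fix x w assume x: "(\<Gamma> ++ (\<lambda>z. if z \<in> set xs then Some v else None)) x = Some w"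
    show "\<exists>y. same_var (zip xs ys @ ls) x y \<and>
      (\<Gamma>' ++ (\<lambda>z. if z \<in> set ys then Some v else None)) y = Some w"
    proof (cases "x \<in> set xs")
      case True
      with x ex(1)[of x] show ?thesis by (auto simp: map_add_def sv dest: set_zip_rightD)
    next
      case False
      with x have "\<Gamma> x = Some w" by (simp add: map_add_def)
      with assms(1) obtain y where y: "same_var ls x y" "\<Gamma>' y = Some w"
        unfolding ctx_rel_def by blast
      with fresh have "y \<notin> set ys" by auto
      with y False show ?thesis by (intro exI[of _ y]) (auto simp: map_add_def sv)
    qed
  next
    fix y w assume y: "(\<Gamma>' ++ (\<lambda>z. if z \<in> set ys then Some v else None)) y = Some w"
    show "\<exists>x. same_var (zip xs ys @ ls) x y \<and>
      (\<Gamma> ++ (\<lambda>z. if z \<in> set xs then Some v else None)) x = Some w"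
    proof (cases "y \<in> set ys")
      case True
      with y ex(2)[of y] show ?thesis by (auto simp: map_add_def sv dest: set_zip_leftD)
    next
      case False
      with y have "\<Gamma>' y = Some w" by (simp add: map_add_def)
      with assms(1) obtain x where x: "same_var ls x y" "\<Gamma> x = Some w"
        unfolding ctx_rel_def by blast
      with assms(4) have "x \<notin> set xs" by auto
      with x False show ?thesis by (intro exI[of _ x]) (auto simp: map_add_def sv)
    qed
  qed
qed

lemma ctx_rel_binder1:
  assumes "ctx_rel ls \<Gamma> \<Gamma>'" "rel_set (same_var ((x, y) # ls)) A B" "dom \<Gamma> \<subseteq> A" "x \<notin> dom \<Gamma>"
  shows "y \<notin> dom \<Gamma>'" and "ctx_rel ((x, y) # ls) (\<Gamma>(x \<mapsto> v)) (\<Gamma>'(y \<mapsto> v))"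
proof -
  have *: "\<Delta> ++ (\<lambda>w. if w \<in> set [z] then Some v else None) = \<Delta>(z \<mapsto> v)" for \<Delta> :: lctx and z
    by (auto simp: map_add_def)
  have "ctx_rel (zip [x] [y] @ ls) (\<Gamma>(x \<mapsto> v)) (\<Gamma>'(y \<mapsto> v))"
    using ctx_rel_binder(2)[of ls \<Gamma> \<Gamma>' "[x]" "[y]" A B v] assms unfolding * by simp
  then show "ctx_rel ((x, y) # ls) (\<Gamma>(x \<mapsto> v)) (\<Gamma>'(y \<mapsto> v))" by simp
  show "y \<notin> dom \<Gamma>'"
    using ctx_rel_binder(1)[of ls \<Gamma> \<Gamma>' "[x]" "[y]" A B] assms by simp
qed

section \<open>Invariance of well-formedness under alpha-equivalence\<close>

text \<open>\<open>R\<close> is abstract so that it can be instantiated with alpha-equivalence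
  paired with the induction hypothesis, which is how \<open>alpha.induct\<close> presents the
  elements of bags. The element to split off is dictated by the multiset, not by the derivation,
  hence \<open>wf_lbag_remove\<close>.\<close>

lemma wf_lbag_rel_mset:
  assumes "rel_mset R C D" "wf_lbag \<Theta> \<Gamma> C \<pi>" "ctx_rel ls \<Gamma> \<Gamma>'"
    and "\<And>M N \<Gamma> \<Gamma>' \<sigma>. R M N \<Longrightarrow> wf_trm \<Theta> \<Gamma> M \<sigma> \<Longrightarrow> ctx_rel ls \<Gamma> \<Gamma>' \<Longrightarrow> wf_trm \<Theta>' \<Gamma>' N \<sigma>"
  shows "wf_lbag \<Theta>' \<Gamma>' D \<pi>"
  using assms(1-3)
proof (induction C arbitrary: D \<Gamma> \<Gamma>' \<pi>)
  case empty
  then show ?case by (auto simp: wf_lbag_empty_iff)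
next
  case (add M C)
  from add.prems(1) obtain N E where D: "D = add_mset N E" "R M N" "rel_mset R C E"
    using msed_rel_invL by metis
  from wf_lbag_remove[OF add.prems(2), of M] obtain \<Gamma>\<^sub>1 \<Gamma>\<^sub>2 \<sigma> k where
    *: "\<Gamma> = \<Gamma>\<^sub>1 ++ \<Gamma>\<^sub>2" "dom \<Gamma>\<^sub>1 \<inter> dom \<Gamma>\<^sub>2 = {}" "\<pi> = replicate_mset (k + 1) \<sigma>"
      "wf_trm \<Theta> \<Gamma>\<^sub>1 M \<sigma>" "wf_lbag \<Theta> \<Gamma>\<^sub>2 C (replicate_mset k \<sigma>)"
    by auto
  obtain \<Gamma>\<^sub>1' \<Gamma>\<^sub>2' where **: "\<Gamma>' = \<Gamma>\<^sub>1' ++ \<Gamma>\<^sub>2'" "dom \<Gamma>\<^sub>1' \<inter> dom \<Gamma>\<^sub>2' = {}"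
    "ctx_rel ls \<Gamma>\<^sub>1 \<Gamma>\<^sub>1'" "ctx_rel ls \<Gamma>\<^sub>2 \<Gamma>\<^sub>2'"
    using ctx_rel_add[OF add.prems(3)[unfolded *(1)] *(2)] .
  show ?case
    unfolding D(1) *(3) **(1)
    using assms(4)[OF D(2) *(4) **(3)] add.IH[OF D(3) *(5) **(4)] **(2) by (rule bag_lin)
qed

lemma wf_ubag_rel_nelist:
  assumes "rel_nelist (rel_option R) U V" "wf_ubag \<Theta> Map.empty U \<epsilon>"
    and "\<And>M N \<sigma>. R M N \<Longrightarrow> wf_trm \<Theta> Map.empty M \<sigma> \<Longrightarrow> wf_trm \<Theta>' Map.empty N \<sigma>"
  shows "wf_ubag \<Theta>' Map.empty V \<epsilon>"
proof -
  have "wf_trm \<Theta>' Map.empty N (list_of \<epsilon> ! i)"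
    if "i < length (list_of U)" "list_of V ! i = Some N" for i N
  proof -
    have "rel_option R (list_of U ! i) (Some N)"
      using assms(1) that unfolding rel_nelist_list_of by (metis list_all2_nthD)
    then obtain M where "list_of U ! i = Some M" "R M N"
      by (auto simp: option_rel_Some2)
    with assms(2) that(1) have "wf_trm \<Theta> Map.empty M (list_of \<epsilon> ! i)"
      by (simp add: wf_ubag_iff list_all2_conv_all_nth)
    with \<open>R M N\<close> show ?thesis by (rule assms(3))
  qed
  then show ?thesis
    using assms(1,2) by (simp add: wf_ubag_iff rel_nelist_list_of list_all2_conv_all_nth)
qed

text \<open>Rules \<open>abs_sh\<close> and \<open>esub\<close> demand that the body share the very
  variable being bound. As \<open>x\<close> is bound innermost, its partner can only be
  \<open>y\<close>, so renaming keeps this shape.\<close>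

lemma alpha_Share:
  assumes "alpha ((x, y) # ls) us (Share M xs x) N"
  obtains M' ys where "N = Share M' ys y"
  using assms by cases (simp split: if_splits)

text \<open>Unrestricted contexts may mention names that do not occur, so equal types at matched
  names are the right invariant here; no counterpart of \<open>ctx_rel\<close> is called
  for.\<close>

lemma same_var_upd:
  assumes "\<And>x y. same_var us x y \<Longrightarrow> \<Theta> x = \<Theta>' y" "same_var ((a, b) # us) x y"
  shows "(\<Theta>(a \<mapsto> \<eta>)) x = (\<Theta>'(b \<mapsto> \<eta>)) y"
proof (cases "x = a")
  case False
  with assms(2) have "y \<noteq> b" "same_var us x y" by (auto split: if_splits)
  with False assms(1)[of x y] show ?thesis by simp
qed (use assms(2) in simp)

lemma wf_trm_alpha:
  assumes "alpha ls us M N" "wf_trm \<Theta> \<Gamma> M \<tau>" "ctx_rel ls \<Gamma> \<Gamma>'"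
    and "\<And>x y. same_var us x y \<Longrightarrow> \<Theta> x = \<Theta>' y"
  shows "wf_trm \<Theta>' \<Gamma>' N \<tau>"
  using assms
proof (induction arbitrary: \<Theta> \<Gamma> \<tau> \<Theta>' \<Gamma>' rule: alpha.induct)
  case (1 ls x y us)
  then show ?case unfolding wf_Var_iff using ctx_rel_single by blast
next
  case (2 us x y ls i)
  then show ?case by (auto simp: wf_UVar_iff)
next
  case (3 x y ls us M N)
  from 3(3) obtain L xs k \<sigma> \<eta> \<rho> where
    *: "M = Share L xs x" "\<tau> = TArr (replicate_mset k \<sigma>) \<eta> \<rho>" "x \<notin> dom \<Gamma>"
      "wf_trm (\<Theta>(x \<mapsto> \<eta>)) (\<Gamma>(x \<mapsto> replicate_mset k \<sigma>)) M \<rho>"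
    unfolding wf_Lam_iff by blast
  obtain L' ys where N: "N = Share L' ys y"
    using 3(1)[unfolded *(1)] by (rule alpha_Share)
  \<comment> \<open>Exactness of the extended context puts all of \<open>dom \<Gamma>\<close> among
    the free variables of the body, the condition under which the renamed binder is fresh.\<close>
  have dom: "dom \<Gamma> \<subseteq> lfv M" using wf_trm_dom[OF *(4)] by auto
  note bind = ctx_rel_binder1[OF 3(4) alpha_lfv[OF 3(1)] dom *(3)]
  have "wf_trm (\<Theta>'(y \<mapsto> \<eta>)) (\<Gamma>'(y \<mapsto> replicate_mset k \<sigma>)) N \<rho>"
    by (rule 3(2)[OF *(4) bind(2)]) (rule same_var_upd[OF 3(5)])
  with bind(1) show ?case
    unfolding N *(2) by (intro abs_sh)
next
  case (4 ls us M N C D U V)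
  from 4(5) obtain \<Gamma>\<^sub>1 \<Gamma>\<^sub>2 j k \<sigma> \<eta> \<epsilon> where
    *: "\<Gamma> = \<Gamma>\<^sub>1 ++ \<Gamma>\<^sub>2" "dom \<Gamma>\<^sub>1 \<inter> dom \<Gamma>\<^sub>2 = {}" "\<eta> \<sim> \<epsilon>"
      "wf_trm \<Theta> \<Gamma>\<^sub>1 M (TArr (replicate_mset j \<sigma>) \<eta> \<tau>)"
      "wf_lbag \<Theta> \<Gamma>\<^sub>2 C (replicate_mset k \<sigma>)" "wf_ubag \<Theta> Map.empty U \<epsilon>"
    unfolding wf_App_iff by blast
  obtain \<Gamma>\<^sub>1' \<Gamma>\<^sub>2' where **: "\<Gamma>' = \<Gamma>\<^sub>1' ++ \<Gamma>\<^sub>2'" "dom \<Gamma>\<^sub>1' \<inter> dom \<Gamma>\<^sub>2' = {}"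
    "ctx_rel ls \<Gamma>\<^sub>1 \<Gamma>\<^sub>1'" "ctx_rel ls \<Gamma>\<^sub>2 \<Gamma>\<^sub>2'"
    using ctx_rel_add[OF 4(6)[unfolded *(1)] *(2)] .
  have N: "wf_trm \<Theta>' \<Gamma>\<^sub>1' N (TArr (replicate_mset j \<sigma>) \<eta> \<tau>)"
    using 4(2)[OF *(4) **(3) 4(7)] .
  have D: "wf_lbag \<Theta>' \<Gamma>\<^sub>2' D (replicate_mset k \<sigma>)"
    by (rule wf_lbag_rel_mset[OF 4(3) *(5) **(4)]) (simp add: 4(7))
  have V: "wf_ubag \<Theta>' Map.empty V \<epsilon>"
    by (rule wf_ubag_rel_nelist[OF 4(4) *(6)]) (simp add: 4(7))
  show ?case
    unfolding **(1) by (rule app[OF N bag[OF D V] *(3) **(2)])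
next
  case (5 ls X Y us)
  from 5(2) have \<Gamma>: "dom \<Gamma> = fset X" "\<And>z. \<Gamma> z \<noteq> Some {#}"
    unfolding wf_Fail_iff by auto
  have "rel_set (same_var ls) (fset X) (fset Y)"
    using 5(1) by (simp add: rel_fset.rep_eq)
  moreover have "rel_set (same_var ls) (fset X) (dom \<Gamma>')"
    using ctx_rel_dom[OF 5(3)] \<Gamma>(1) by simp
  \<comment> \<open>Both sets consist of partners of \<open>fset X\<close>, and partners are
    unique.\<close>
  ultimately have "dom \<Gamma>' = fset Y"
    unfolding rel_set_def by (metis same_var_unique(1) subsetI subset_antisym)
  moreover have "\<Gamma>' z \<noteq> Some {#}" for z
    using 5(3) \<Gamma>(2) unfolding ctx_rel_def by metis
  ultimately show ?case
    unfolding wf_Fail_iff by blast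
next
  case (6 xs ys ls us M N x y)
  from 6(7) obtain \<Delta> \<sigma> where
    *: "\<Gamma> = \<Delta>(x \<mapsto> replicate_mset (length xs) \<sigma>)" "x \<notin> dom \<Delta>" "set xs \<inter> dom \<Delta> = {}"
      "wf_trm \<Theta> (add_vars \<Delta> xs \<sigma>) M \<tau>"
    unfolding wf_Share_iff by blast
  obtain \<Delta>' where **: "\<Gamma>' = \<Delta>'(y \<mapsto> replicate_mset (length xs) \<sigma>)" "y \<notin> dom \<Delta>'" "ctx_rel ls \<Delta> \<Delta>'"
    using ctx_rel_upd[OF 6(8)[unfolded *(1)] 6(5) *(2)] .
  have dom: "dom \<Delta> \<subseteq> lfv M" using wf_trm_dom[OF *(4)] by auto
  note bind = ctx_rel_binder[OF **(3) alpha_lfv[OF 6(4)] dom *(3) 6(1-3)]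
  have "wf_trm \<Theta>' (add_vars \<Delta>' ys \<sigma>) N \<tau>"
    by (rule 6(6)[OF *(4) _ 6(9)]) (use bind(2) in \<open>simp_all add: add_vars_def\<close>)
  with bind(1) ** 6(1,3) show ?case
    unfolding wf_Share_iff by metis
next
  case (7 x y ls us M N C D U V)
  from 7(5) obtain L xs \<Gamma>\<^sub>1 \<Gamma>\<^sub>2 j k \<sigma> \<eta> \<epsilon> where
    *: "\<Gamma> = \<Gamma>\<^sub>1 ++ \<Gamma>\<^sub>2" "dom \<Gamma>\<^sub>1 \<inter> dom \<Gamma>\<^sub>2 = {}" "\<eta> \<sim> \<epsilon>"
      "wf_trm (\<Theta>(x \<mapsto> \<eta>)) (\<Gamma>\<^sub>1(x \<mapsto> replicate_mset j \<sigma>)) M \<tau>"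
      "wf_lbag \<Theta> \<Gamma>\<^sub>2 C (replicate_mset k \<sigma>)" "wf_ubag \<Theta> Map.empty U \<epsilon>"
      "x \<notin> dom \<Gamma>\<^sub>1" "M = Share L xs x"
    unfolding wf_ISub_iff by blast
  obtain \<Gamma>\<^sub>1' \<Gamma>\<^sub>2' where **: "\<Gamma>' = \<Gamma>\<^sub>1' ++ \<Gamma>\<^sub>2'" "dom \<Gamma>\<^sub>1' \<inter> dom \<Gamma>\<^sub>2' = {}"
    "ctx_rel ls \<Gamma>\<^sub>1 \<Gamma>\<^sub>1'" "ctx_rel ls \<Gamma>\<^sub>2 \<Gamma>\<^sub>2'"
    using ctx_rel_add[OF 7(6)[unfolded *(1)] *(2)] .
  obtain L' ys where N: "N = Share L' ys y"
    using 7(1)[unfolded *(8)] by (rule alpha_Share)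
  have dom: "dom \<Gamma>\<^sub>1 \<subseteq> lfv M" using wf_trm_dom[OF *(4)] by auto
  note bind = ctx_rel_binder1[OF **(3) alpha_lfv[OF 7(1)] dom *(7)]
  have body: "wf_trm (\<Theta>'(y \<mapsto> \<eta>)) (\<Gamma>\<^sub>1'(y \<mapsto> replicate_mset j \<sigma>)) N \<tau>"
    by (rule 7(2)[OF *(4) bind(2)]) (rule same_var_upd[OF 7(7)])
  have D: "wf_lbag \<Theta>' \<Gamma>\<^sub>2' D (replicate_mset k \<sigma>)"
    by (rule wf_lbag_rel_mset[OF 7(3) *(5) **(4)]) (simp add: 7(7))
  have V: "wf_ubag \<Theta>' Map.empty V \<epsilon>"
    by (rule wf_ubag_rel_nelist[OF 7(4) *(6)]) (simp add: 7(7))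
  show ?case
    unfolding **(1) N by (rule esub[OF body[unfolded N] bind(1) bag[OF D V] *(3) **(2)])
next
  case (8 xs ys ls us M N C D)
  from 8(7) obtain \<Gamma>\<^sub>1 \<Gamma>\<^sub>2 \<sigma> where
    *: "\<Gamma> = \<Gamma>\<^sub>1 ++ \<Gamma>\<^sub>2" "dom \<Gamma>\<^sub>1 \<inter> dom \<Gamma>\<^sub>2 = {}" "set xs \<inter> dom \<Gamma>\<^sub>1 = {}"
      "wf_trm \<Theta> (add_vars \<Gamma>\<^sub>1 xs \<sigma>) M \<tau>" "wf_lbag \<Theta> \<Gamma>\<^sub>2 C (replicate_mset (length xs) \<sigma>)"
    unfolding wf_LSub_iff by blast
  obtain \<Gamma>\<^sub>1' \<Gamma>\<^sub>2' where **: "\<Gamma>' = \<Gamma>\<^sub>1' ++ \<Gamma>\<^sub>2'" "dom \<Gamma>\<^sub>1' \<inter> dom \<Gamma>\<^sub>2' = {}"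
    "ctx_rel ls \<Gamma>\<^sub>1 \<Gamma>\<^sub>1'" "ctx_rel ls \<Gamma>\<^sub>2 \<Gamma>\<^sub>2'"
    using ctx_rel_add[OF 8(8)[unfolded *(1)] *(2)] .
  have dom: "dom \<Gamma>\<^sub>1 \<subseteq> lfv M" using wf_trm_dom[OF *(4)] by auto
  note bind = ctx_rel_binder[OF **(3) alpha_lfv[OF 8(4)] dom *(3) 8(1-3)]
  have N: "wf_trm \<Theta>' (add_vars \<Gamma>\<^sub>1' ys \<sigma>) N \<tau>"
    by (rule 8(5)[OF *(4) _ 8(9)]) (use bind(2) in \<open>simp_all add: add_vars_def\<close>)
  have D: "wf_lbag \<Theta>' \<Gamma>\<^sub>2' D (replicate_mset (length ys) \<sigma>)"
    unfolding 8(1)[symmetric] by (rule wf_lbag_rel_mset[OF 8(6) *(5) **(4)]) (simp add: 8(9))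
  show ?case
    unfolding **(1) by (rule esub_lin[OF N 8(3) bind(1) refl D **(2)])
next
  case (9 ls x y us M N U V)
  from 9(4) obtain \<eta> \<epsilon> where
    *: "\<eta> \<sim> \<epsilon>" "wf_trm (\<Theta>(x \<mapsto> \<eta>)) \<Gamma> M \<tau>" "wf_ubag \<Theta> Map.empty U \<epsilon>"
    unfolding wf_USub_iff by blast
  have N: "wf_trm (\<Theta>'(y \<mapsto> \<eta>)) \<Gamma>' N \<tau>"
    by (rule 9(2)[OF *(2) 9(5)]) (rule same_var_upd[OF 9(6)])
  have V: "wf_ubag \<Theta>' Map.empty V \<epsilon>"
    by (rule wf_ubag_rel_nelist[OF 9(3) *(3)]) (simp add: 9(6))
  show ?case
    by (rule esub_unr[OF N V *(1)])
qed

lemma wf_trm_alpha_eq: "M \<approx>\<^sub>\<alpha> N \<Longrightarrow> wf_trm \<Theta> \<Gamma> M \<tau> \<Longrightarrow> wf_trm \<Theta> \<Gamma> N \<tau>"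
  using wf_trm_alpha[of "[]" "[]" M N \<Theta> \<Gamma> \<tau> \<Gamma> \<Theta>] by (simp add: ctx_rel_refl)

section \<open>Variables on the spine\<close>

text \<open>
  Only the positions that an evaluation context can reach matter. Restricted to them, the syntactic
  condition on terms and the two notions of free variables avoid all bags, which makes their
  invariance under \<open>\<alpha>\<close>-equivalence immediate.
\<close>

primrec spine_sharing :: "trm \<Rightarrow> var set" where
  "spine_sharing (Var x) = {}"
| "spine_sharing (UVar x i) = {}"
| "spine_sharing (Lam x M) = {}"
| "spine_sharing (App M C U) = spine_sharing M"
| "spine_sharing (Fail X) = {}"
| "spine_sharing (Share M xs x) = insert x (spine_sharing M - set xs)"
| "spine_sharing (ISub M C U x) = {}"
| "spine_sharing (LSub M C xs) = spine_sharing M - set xs"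
| "spine_sharing (USub M U x) = spine_sharing M"

primrec spine_fail :: "trm \<Rightarrow> var set" where
  "spine_fail (Var x) = {}"
| "spine_fail (UVar x i) = {}"
| "spine_fail (Lam x M) = {}"
| "spine_fail (App M C U) = spine_fail M"
| "spine_fail (Fail X) = fset X"
| "spine_fail (Share M xs x) = spine_fail M - set xs"
| "spine_fail (ISub M C U x) = {}"
| "spine_fail (LSub M C xs) = spine_fail M - set xs"
| "spine_fail (USub M U x) = spine_fail M"

text \<open>Of the conditions in \<open>lc_term\<close> this keeps the one that fetching relies on:
  a variable bound by a linear substitution is not a sharing variable on the spine of the
  body.\<close>

primrec spine_ok :: "trm \<Rightarrow> bool" where
  "spine_ok (Var x) \<longleftrightarrow> True"
| "spine_ok (UVar x i) \<longleftrightarrow> True"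
| "spine_ok (Lam x M) \<longleftrightarrow> True"
| "spine_ok (App M C U) \<longleftrightarrow> spine_ok M"
| "spine_ok (Fail X) \<longleftrightarrow> True"
| "spine_ok (Share M xs x) \<longleftrightarrow> spine_ok M"
| "spine_ok (ISub M C U x) \<longleftrightarrow> True"
| "spine_ok (LSub M C xs) \<longleftrightarrow> spine_ok M \<and> set xs \<inter> spine_sharing M = {}"
| "spine_ok (USub M U x) \<longleftrightarrow> spine_ok M"

lemma spine_sharing_subset: "spine_sharing M \<subseteq> sharing_vars M"
  by (induction M) auto

lemma spine_fail_subset: "spine_fail M \<subseteq> fail_vars M"
  by (induction M) auto

lemma lc_term_spine_ok: "lc_term M \<Longrightarrow> spine_ok M"
  by (induction rule: lc_term.induct) (use spine_sharing_subset in auto)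

lemma alpha_spine_sharing:
  "alpha ls us M N \<Longrightarrow> rel_set (same_var ls) (spine_sharing M) (spine_sharing N)"
  by (induction rule: alpha.induct)
    (auto intro!: empty_transfer rel_set_insert rel_set_same_var_diff)

lemma alpha_spine_fail:
  "alpha ls us M N \<Longrightarrow> rel_set (same_var ls) (spine_fail M) (spine_fail N)"
  by (induction rule: alpha.induct)
    (auto simp: rel_fset.rep_eq intro!: empty_transfer rel_set_same_var_diff)

lemma alpha_eq_spine_fail: "M \<approx>\<^sub>\<alpha> N \<Longrightarrow> spine_fail M = spine_fail N"
  using alpha_spine_fail[of "[]" "[]" M N] by (simp add: same_var_Nil rel_set_eq)

lemma alpha_spine_ok: "alpha ls us M N \<Longrightarrow> spine_ok M \<Longrightarrow> spine_ok N"
proof (induction rule: alpha.induct)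
  case (8 xs ys ls us M N C D)
  have "y \<notin> spine_sharing N" if "y \<in> set ys" for y
  proof
    assume "y \<in> spine_sharing N"
    with alpha_spine_sharing[OF 8(4)] obtain x
      where "x \<in> spine_sharing M" "same_var (zip xs ys @ ls) x y"
      by (auto dest: rel_setD2)
    with that 8(7) show False
      unfolding same_var_zip[OF 8(1-3)] by (auto dest: set_zip_leftD)
  qed
  with 8 show ?case by auto
qed auto


section \<open>Substitution for the head\<close>

text \<open>This locates the resource for \<open>y\<close>: when a linear context is split between a
  term and a bag, \<open>y\<close> belongs to the part of the term that contains the head.\<close>

lemma head_lfv: "head M = Var y \<Longrightarrow> y \<notin> head_lbinders M \<Longrightarrow> y \<in> lfv M"
  by (induction M) (auto split: if_splits)

text \<open>
  The condition on \<open>spine_sharing\<close> excludes that \<open>y\<close> is the head only because it shares the actual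
  head variable, in which case \<open>head_subst\<close> does not replace anything.
\<close>

lemma wf_head_subst_lin:
  assumes "wf_trm \<Theta> \<Gamma> M \<tau>" "head M = Var y" "\<Gamma> y = Some {#\<sigma>#}" "y \<notin> spine_sharing M"
    and "wf_trm \<Theta> \<Delta> N \<sigma>" "(dom \<Gamma> - {y}) \<inter> dom \<Delta> = {}"
    and "head_lbinders M \<inter> insert y (dom \<Delta>) = {}" "head_ubinders M \<inter> ufv N = {}"
  shows "wf_trm \<Theta> (\<Gamma>(y := None) ++ \<Delta>) (head_subst (Var y) N M) \<tau>"
  using assms
proof (induction M arbitrary: \<Theta> \<Gamma> \<tau>)
  case (Var x)
  then have "x = y" "\<Gamma>(y := None) = Map.empty" "\<tau> = \<sigma>"
    unfolding wf_Var_iff by auto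
  with Var.prems(5) show ?case by simp
next
  case (App M C U)
  from App.prems(1) obtain \<Gamma>\<^sub>1 \<Gamma>\<^sub>2 j k \<rho> \<eta> \<epsilon> where
    *: "\<Gamma> = \<Gamma>\<^sub>1 ++ \<Gamma>\<^sub>2" "dom \<Gamma>\<^sub>1 \<inter> dom \<Gamma>\<^sub>2 = {}" "\<eta> \<sim> \<epsilon>"
      "wf_trm \<Theta> \<Gamma>\<^sub>1 M (TArr (replicate_mset j \<rho>) \<eta> \<tau>)"
      "wf_lbag \<Theta> \<Gamma>\<^sub>2 C (replicate_mset k \<rho>)" "wf_ubag \<Theta> Map.empty U \<epsilon>"
    unfolding wf_App_iff by blast
  have "y \<in> dom \<Gamma>\<^sub>1"
    using head_lfv[of M y] App.prems wf_trm_dom[OF *(4)] by simp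
  then have y: "y \<notin> dom \<Gamma>\<^sub>2" using *(2) by auto
  then have "\<Gamma>\<^sub>1 y = Some {#\<sigma>#}" using App.prems(3) *(1) by (simp add: map_add_dom_app_simps)
  then have "wf_trm \<Theta> (\<Gamma>\<^sub>1(y := None) ++ \<Delta>) (head_subst (Var y) N M) (TArr (replicate_mset j \<rho>) \<eta> \<tau>)"
    using App.prems *(1) by (intro App.IH(1)[OF *(4)]) auto
  \<comment> \<open>The context of the inserted term appears inside the function part and has to be
    commuted with the context of the bag.\<close>
  moreover have "\<Gamma>(y := None) ++ \<Delta> = (\<Gamma>\<^sub>1(y := None) ++ \<Delta>) ++ \<Gamma>\<^sub>2"
  proof -
    have "dom \<Gamma>\<^sub>2 \<inter> dom \<Delta> = {}" using App.prems(6) y *(1) by auto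
    then have "\<Delta> ++ \<Gamma>\<^sub>2 = \<Gamma>\<^sub>2 ++ \<Delta>" by (rule map_add_comm[symmetric])
    moreover have "\<Gamma>(y := None) = \<Gamma>\<^sub>1(y := None) ++ \<Gamma>\<^sub>2"
      using y *(1) by (auto simp: fun_eq_iff map_add_def split: option.splits)
    ultimately show ?thesis by (metis map_add_assoc)
  qed
  moreover have "dom (\<Gamma>\<^sub>1(y := None) ++ \<Delta>) \<inter> dom \<Gamma>\<^sub>2 = {}"
    using App.prems(6) y *(1,2) by auto
  ultimately show ?case
    using *(3,5,6) unfolding head_subst.simps wf_App_iff by blast
next
  case (Share M xs x)
  from Share.prems(1) obtain \<Gamma>' \<rho> where
    *: "\<Gamma> = \<Gamma>'(x \<mapsto> replicate_mset (length xs) \<rho>)" "x \<notin> dom \<Gamma>'" "set xs \<inter> dom \<Gamma>' = {}"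
      "wf_trm \<Theta> (add_vars \<Gamma>' xs \<rho>) M \<tau>" "distinct xs"
    unfolding wf_Share_iff by blast
  \<comment> \<open>The sharing variable \<open>x\<close> belongs to \<open>spine_sharing\<close>,
    so it differs from \<open>y\<close>; hence \<open>y\<close> is already the head of the
    body.\<close>
  have xy: "x \<noteq> y" "head M = Var y" "y \<notin> set xs" "y \<notin> spine_sharing M" "set xs \<inter> dom \<Delta> = {}"
    using Share.prems by (auto split: if_splits)
  then have x: "x \<notin> dom \<Delta>" using Share.prems(6) *(1) by auto
  have "wf_trm \<Theta> ((add_vars \<Gamma>' xs \<rho>)(y := None) ++ \<Delta>) (head_subst (Var y) N M) \<tau>"
  proof (rule Share.IH[OF *(4) xy(2) _ xy(4) Share.prems(5)])
    have "\<Gamma>' y = Some {#\<sigma>#}" using Share.prems(3) *(1) xy(1) by simp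
    then show "add_vars \<Gamma>' xs \<rho> y = Some {#\<sigma>#}" using xy(3) by (simp add: add_vars_def map_add_def)
    have "dom \<Gamma> = insert x (dom \<Gamma>')" unfolding *(1) dom_fun_upd by simp
    with Share.prems(6) xy(5) show "(dom (add_vars \<Gamma>' xs \<rho>) - {y}) \<inter> dom \<Delta> = {}" by auto
  qed (use Share.prems(7,8) in auto)
  moreover have "(add_vars \<Gamma>' xs \<rho>)(y := None) ++ \<Delta> = add_vars (\<Gamma>'(y := None) ++ \<Delta>) xs \<rho>"
    using xy by (auto simp: fun_eq_iff add_vars_def map_add_def split: option.splits)
  moreover have "\<Gamma>(y := None) ++ \<Delta> = (\<Gamma>'(y := None) ++ \<Delta>)(x \<mapsto> replicate_mset (length xs) \<rho>)"
    using xy x *(1) by (auto simp: fun_eq_iff map_add_def split: option.splits)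
  moreover have "x \<notin> dom (\<Gamma>'(y := None) ++ \<Delta>)" "set xs \<inter> dom (\<Gamma>'(y := None) ++ \<Delta>) = {}"
    using x xy *(2,3) by auto
  ultimately show ?case
    using *(5) unfolding head_subst.simps wf_Share_iff by metis
next
  case (LSub M C xs)
  from LSub.prems(1) obtain \<Gamma>\<^sub>1 \<Gamma>\<^sub>2 \<rho> where
    *: "\<Gamma> = \<Gamma>\<^sub>1 ++ \<Gamma>\<^sub>2" "dom \<Gamma>\<^sub>1 \<inter> dom \<Gamma>\<^sub>2 = {}" "set xs \<inter> dom \<Gamma>\<^sub>1 = {}"
      "wf_trm \<Theta> (add_vars \<Gamma>\<^sub>1 xs \<rho>) M \<tau>" "wf_lbag \<Theta> \<Gamma>\<^sub>2 C (replicate_mset (length xs) \<rho>)" "distinct xs"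
    unfolding wf_LSub_iff by blast
  have xs: "y \<notin> set xs" "set xs \<inter> dom \<Delta> = {}" "y \<notin> spine_sharing M"
    using LSub.prems by auto
  have "y \<in> dom \<Gamma>\<^sub>1"
    using head_lfv[of M y] LSub.prems(2,7) wf_trm_dom[OF *(4)] xs(1) by (auto simp del: domIff)
  then have y: "y \<notin> dom \<Gamma>\<^sub>2" using *(2) by auto
  then have y1: "\<Gamma>\<^sub>1 y = Some {#\<sigma>#}" using LSub.prems(3) *(1) by (simp add: map_add_dom_app_simps)
  have "wf_trm \<Theta> ((add_vars \<Gamma>\<^sub>1 xs \<rho>)(y := None) ++ \<Delta>) (head_subst (Var y) N M) \<tau>"
  proof (intro LSub.IH(1)[OF *(4) _ _ xs(3) LSub.prems(5)])
    show "add_vars \<Gamma>\<^sub>1 xs \<rho> y = Some {#\<sigma>#}"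
      using y1 xs(1) by (simp add: add_vars_def map_add_def)
    show "(dom (add_vars \<Gamma>\<^sub>1 xs \<rho>) - {y}) \<inter> dom \<Delta> = {}"
      using LSub.prems(6) xs(2) *(1) by auto
  qed (use LSub.prems(2,7,8) in auto)
  moreover have "(add_vars \<Gamma>\<^sub>1 xs \<rho>)(y := None) ++ \<Delta> = add_vars (\<Gamma>\<^sub>1(y := None) ++ \<Delta>) xs \<rho>"
    using xs by (auto simp: fun_eq_iff add_vars_def map_add_def split: option.splits)
  moreover have "\<Gamma>(y := None) ++ \<Delta> = (\<Gamma>\<^sub>1(y := None) ++ \<Delta>) ++ \<Gamma>\<^sub>2"
  proof -
    have "dom \<Gamma>\<^sub>2 \<inter> dom \<Delta> = {}" using LSub.prems(6) y *(1) by auto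
    then have "\<Delta> ++ \<Gamma>\<^sub>2 = \<Gamma>\<^sub>2 ++ \<Delta>" by (rule map_add_comm[symmetric])
    moreover have "\<Gamma>(y := None) = \<Gamma>\<^sub>1(y := None) ++ \<Gamma>\<^sub>2"
      using y *(1) by (auto simp: fun_eq_iff map_add_def split: option.splits)
    ultimately show ?thesis by (metis map_add_assoc)
  qed
  moreover have "dom (\<Gamma>\<^sub>1(y := None) ++ \<Delta>) \<inter> dom \<Gamma>\<^sub>2 = {}" "set xs \<inter> dom (\<Gamma>\<^sub>1(y := None) ++ \<Delta>) = {}"
    using LSub.prems(6) y xs *(1,2,3) by auto
  ultimately show ?case
    using *(5,6) unfolding head_subst.simps wf_LSub_iff by metis
next
  case (USub M U x)
  from USub.prems(1) obtain \<eta> \<epsilon> where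
    *: "\<eta> \<sim> \<epsilon>" "wf_trm (\<Theta>(x \<mapsto> \<eta>)) \<Gamma> M \<tau>" "wf_ubag \<Theta> Map.empty U \<epsilon>"
    unfolding wf_USub_iff by blast
  \<comment> \<open>The inserted term passes below a binder of \<open>x[i]\<close>, which captures
    nothing by the condition on \<open>head_ubinders\<close>.\<close>
  have N: "wf_trm (\<Theta>(x \<mapsto> \<eta>)) \<Delta> N \<sigma>"
    using USub.prems(8) by (intro wf_trm_cong_uctx[OF USub.prems(5)]) auto
  have "wf_trm (\<Theta>(x \<mapsto> \<eta>)) (\<Gamma>(y := None) ++ \<Delta>) (head_subst (Var y) N M) \<tau>"
    by (rule USub.IH(1)[OF *(2) _ USub.prems(3) _ N USub.prems(6)]) (use USub.prems(2,4,7,8) in auto)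
  with * show ?case unfolding head_subst.simps wf_USub_iff by blast
qed auto

text \<open>Both the occurrence and its replacement are typed in the empty linear context, so
  \<open>\<Gamma>\<close> stays the same. The bounds on \<open>i\<close> guard the typing of
  \<open>N\<close> because they only become available at the head itself, by inverting
  \<open>UVar\<close>.\<close>

lemma wf_head_subst_unr:
  assumes "wf_trm \<Theta> \<Gamma> M \<tau>" "head M = UVar x i" "\<Theta> x = Some \<eta>"
    and "1 \<le> i \<Longrightarrow> i \<le> length (list_of \<eta>) \<Longrightarrow> wf_trm \<Theta> Map.empty N (list_of \<eta> ! (i - 1))"
    and "head_ubinders M \<inter> insert x (ufv N) = {}"
  shows "wf_trm \<Theta> \<Gamma> (head_subst (UVar x i) N M) \<tau>"
  using assms
proof (induction M arbitrary: \<Theta> \<Gamma> \<tau>)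
  case (UVar z j)
  then show ?case by (auto simp: wf_UVar_iff)
next
  case (App M C U)
  then have "wf_trm \<Theta> \<Delta> (head_subst (UVar x i) N M) \<rho>" if "wf_trm \<Theta> \<Delta> M \<rho>" for \<Delta> \<rho>
    using that by simp
  with App.prems(1) show ?case unfolding head_subst.simps wf_App_iff by blast
next
  case (Share M xs z)
  then have "wf_trm \<Theta> \<Delta> (head_subst (UVar x i) N M) \<tau>" if "wf_trm \<Theta> \<Delta> M \<tau>" for \<Delta>
    using that by (auto split: if_splits)
  with Share.prems(1) show ?case unfolding head_subst.simps wf_Share_iff by blast
next
  case (LSub M C xs)
  then have "wf_trm \<Theta> \<Delta> (head_subst (UVar x i) N M) \<tau>" if "wf_trm \<Theta> \<Delta> M \<tau>" for \<Delta>
    using that by simp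
  with LSub.prems(1) show ?case unfolding head_subst.simps wf_LSub_iff by blast
next
  case (USub M U z)
  have "wf_trm (\<Theta>(z \<mapsto> \<zeta>)) \<Gamma> (head_subst (UVar x i) N M) \<tau>" if "wf_trm (\<Theta>(z \<mapsto> \<zeta>)) \<Gamma> M \<tau>" for \<zeta>
  proof (rule USub.IH(1)[OF that])
    show "wf_trm (\<Theta>(z \<mapsto> \<zeta>)) Map.empty N (list_of \<eta> ! (i - 1))" if "1 \<le> i" "i \<le> length (list_of \<eta>)"
      using USub.prems(5) by (intro wf_trm_cong_uctx[OF USub.prems(4)[OF that]]) auto
  qed (use USub.prems in auto)
  with USub.prems(1) show ?case unfolding head_subst.simps wf_USub_iff by blast
qed auto


section \<open>Subject reduction\<close>

lemma wf_FailI: "dom \<Gamma> = fset X \<Longrightarrow> (\<And>z. \<Gamma> z = Some {#} \<Longrightarrow> z \<notin> fset X) \<Longrightarrow> wf_trm \<Theta> \<Gamma> (Fail X) \<tau>"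
  unfolding wf_Fail_iff by (metis domI)

text \<open>Variables bound by a frame get singleton types. A variable of empty type at the hole
  therefore comes from outside with the same type and is not bound on the way, so the condition on
  recorded variables descends to the hole. The last premise ranges over all contexts and types
  because frames change them.\<close>

lemma wf_plug:
  assumes "wf_trm \<Theta> \<Gamma> (plug E M) \<tau>" "spine_ok (plug E M)"
    and "\<And>z. \<Gamma> z = Some {#} \<Longrightarrow> z \<notin> spine_fail (plug E N)"
    and "\<And>\<Theta> \<Gamma> \<tau>. wf_trm \<Theta> \<Gamma> M \<tau> \<Longrightarrow> spine_ok M \<Longrightarrow> (\<And>z. \<Gamma> z = Some {#} \<Longrightarrow> z \<notin> spine_fail N)
           \<Longrightarrow> wf_trm \<Theta> \<Gamma> N \<tau>"
  shows "wf_trm \<Theta> \<Gamma> (plug E N) \<tau>"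
  using assms(1-3)
proof (induction E arbitrary: \<Theta> \<Gamma> \<tau>)
  case Hole
  then show ?case using assms(4) by simp
next
  case (CApp E C U)
  from CApp.prems(1) obtain \<Gamma>\<^sub>1 \<Gamma>\<^sub>2 j k \<sigma> \<eta> \<epsilon> where
    *: "\<Gamma> = \<Gamma>\<^sub>1 ++ \<Gamma>\<^sub>2" "dom \<Gamma>\<^sub>1 \<inter> dom \<Gamma>\<^sub>2 = {}" "\<eta> \<sim> \<epsilon>"
      "wf_trm \<Theta> \<Gamma>\<^sub>1 (plug E M) (TArr (replicate_mset j \<sigma>) \<eta> \<tau>)"
      "wf_lbag \<Theta> \<Gamma>\<^sub>2 C (replicate_mset k \<sigma>)" "wf_ubag \<Theta> Map.empty U \<epsilon>"
    unfolding plug.simps wf_App_iff by blast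
  have "\<Gamma> z = Some {#}" if "\<Gamma>\<^sub>1 z = Some {#}" for z
    using that *(1,2) by (metis domI map_add_comm map_add_find_right)
  then have "wf_trm \<Theta> \<Gamma>\<^sub>1 (plug E N) (TArr (replicate_mset j \<sigma>) \<eta> \<tau>)"
    using CApp.prems(2,3) by (intro CApp.IH[OF *(4)]) auto
  with * show ?case unfolding plug.simps wf_App_iff by blast
next
  case (CLSub E C xs)
  from CLSub.prems(1) obtain \<Gamma>\<^sub>1 \<Gamma>\<^sub>2 \<sigma> where
    *: "\<Gamma> = \<Gamma>\<^sub>1 ++ \<Gamma>\<^sub>2" "dom \<Gamma>\<^sub>1 \<inter> dom \<Gamma>\<^sub>2 = {}" "set xs \<inter> dom \<Gamma>\<^sub>1 = {}" "distinct xs"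
      "wf_trm \<Theta> (add_vars \<Gamma>\<^sub>1 xs \<sigma>) (plug E M) \<tau>" "wf_lbag \<Theta> \<Gamma>\<^sub>2 C (replicate_mset (length xs) \<sigma>)"
    unfolding plug.simps wf_LSub_iff by blast
  have "\<Gamma> z = Some {#} \<and> z \<notin> set xs" if "add_vars \<Gamma>\<^sub>1 xs \<sigma> z = Some {#}" for z
  proof -
    have "\<Gamma>\<^sub>1 z = Some {#}" "z \<notin> set xs"
      using that by (auto simp: add_vars_def map_add_def split: if_splits)
    then show ?thesis using *(1,2) by (metis domI map_add_comm map_add_find_right)
  qed
  then have "wf_trm \<Theta> (add_vars \<Gamma>\<^sub>1 xs \<sigma>) (plug E N) \<tau>"
    using CLSub.prems(2,3) by (intro CLSub.IH[OF *(5)]) auto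
  with * show ?case unfolding plug.simps wf_LSub_iff by blast
next
  case (CUSub E U x)
  then have "wf_trm \<Theta>' \<Gamma> (plug E N) \<tau>" if "wf_trm \<Theta>' \<Gamma> (plug E M) \<tau>" for \<Theta>'
    using that by simp
  with CUSub.prems(1) show ?case unfolding plug.simps wf_USub_iff by blast
next
  case (CShare E xs x)
  from CShare.prems(1) obtain \<Delta> \<sigma> where
    *: "\<Gamma> = \<Delta>(x \<mapsto> replicate_mset (length xs) \<sigma>)" "x \<notin> dom \<Delta>" "set xs \<inter> dom \<Delta> = {}"
      "wf_trm \<Theta> (add_vars \<Delta> xs \<sigma>) (plug E M) \<tau>" "distinct xs"
    unfolding plug.simps wf_Share_iff by blast
  have "\<Gamma> z = Some {#} \<and> z \<notin> set xs" if "add_vars \<Delta> xs \<sigma> z = Some {#}" for z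
    using that *(1,2) by (auto simp: add_vars_def map_add_def split: if_splits)
  then have "wf_trm \<Theta> (add_vars \<Delta> xs \<sigma>) (plug E N) \<tau>"
    using CShare.prems(2,3) by (intro CShare.IH[OF *(4)]) auto
  with * show ?case unfolding plug.simps wf_Share_iff by blast
qed

text \<open>Inverting \<open>esub\<close> and then the sharing yields two element types, which must
  be identified for the bag to fit the shared variables. A nonempty multiset determines its element;
  if \<open>xs\<close> is empty, \<open>add_vars\<close> ignores the type.\<close>

lemma wf_ISub_Share:
  assumes "wf_trm \<Theta> \<Gamma> (ISub (Share M xs x) C U x) \<tau>"
  obtains \<Gamma>\<^sub>1 \<Gamma>\<^sub>2 k \<sigma> \<eta> \<epsilon> where "\<Gamma> = \<Gamma>\<^sub>1 ++ \<Gamma>\<^sub>2" "dom \<Gamma>\<^sub>1 \<inter> dom \<Gamma>\<^sub>2 = {}" "\<eta> \<sim> \<epsilon>" "distinct xs"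
    "set xs \<inter> dom \<Gamma>\<^sub>1 = {}" "wf_trm (\<Theta>(x \<mapsto> \<eta>)) (add_vars \<Gamma>\<^sub>1 xs \<sigma>) M \<tau>"
    "wf_lbag \<Theta> \<Gamma>\<^sub>2 C (replicate_mset k \<sigma>)" "wf_ubag \<Theta> Map.empty U \<epsilon>"
proof -
  from assms obtain \<Gamma>\<^sub>1 \<Gamma>\<^sub>2 j k \<sigma> \<eta> \<epsilon> where
    *: "\<Gamma> = \<Gamma>\<^sub>1 ++ \<Gamma>\<^sub>2" "dom \<Gamma>\<^sub>1 \<inter> dom \<Gamma>\<^sub>2 = {}" "\<eta> \<sim> \<epsilon>" "x \<notin> dom \<Gamma>\<^sub>1"
      "wf_trm (\<Theta>(x \<mapsto> \<eta>)) (\<Gamma>\<^sub>1(x \<mapsto> replicate_mset j \<sigma>)) (Share M xs x) \<tau>"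
      "wf_lbag \<Theta> \<Gamma>\<^sub>2 C (replicate_mset k \<sigma>)" "wf_ubag \<Theta> Map.empty U \<epsilon>"
    unfolding wf_ISub_iff by blast
  from *(5) obtain \<Delta> \<rho> where
    **: "\<Gamma>\<^sub>1(x \<mapsto> replicate_mset j \<sigma>) = \<Delta>(x \<mapsto> replicate_mset (length xs) \<rho>)" "x \<notin> dom \<Delta>"
      "set xs \<inter> dom \<Delta> = {}" "wf_trm (\<Theta>(x \<mapsto> \<eta>)) (add_vars \<Delta> xs \<rho>) M \<tau>" "distinct xs"
    unfolding wf_Share_iff by blast
  have "\<Delta> = \<Gamma>\<^sub>1"
  proof
    fix z
    show "\<Delta> z = \<Gamma>\<^sub>1 z"
      using fun_cong[OF **(1), of z] **(2) *(4) by (cases "z = x") (simp_all add: domIff)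
  qed
  moreover have "add_vars \<Gamma>\<^sub>1 xs \<rho> = add_vars \<Gamma>\<^sub>1 xs \<sigma>"
  proof (cases xs)
    case (Cons y ys)
    have "replicate_mset j \<sigma> = replicate_mset (length xs) \<rho>"
      using fun_cong[OF **(1), of x] by simp
    with Cons have "\<rho> = \<sigma>"
      by (metis in_replicate_mset length_greater_0_conv list.distinct(1))
    then show ?thesis by simp
  qed simp
  ultimately show thesis using * ** that by metis
qed

lemma red_preserves_wf:
  assumes "M \<longlongrightarrow>\<^sub>C M'" "wf_trm \<Theta> \<Gamma> M \<tau>" "spine_ok M"
    and "\<And>z. \<Gamma> z = Some {#} \<Longrightarrow> z \<notin> spine_fail M'"
  shows "wf_trm \<Theta> \<Gamma> M' \<tau>"
  using assms
proof (induction arbitrary: \<Theta> \<Gamma> \<tau> rule: red.induct)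
  case (Beta x M C U)
  from Beta(1) obtain \<Gamma>\<^sub>1 \<Gamma>\<^sub>2 j k \<sigma> \<eta> \<epsilon> where
    *: "\<Gamma> = \<Gamma>\<^sub>1 ++ \<Gamma>\<^sub>2" "dom \<Gamma>\<^sub>1 \<inter> dom \<Gamma>\<^sub>2 = {}" "\<eta> \<sim> \<epsilon>"
      "wf_trm \<Theta> \<Gamma>\<^sub>1 (Lam x M) (TArr (replicate_mset j \<sigma>) \<eta> \<tau>)"
      "wf_lbag \<Theta> \<Gamma>\<^sub>2 C (replicate_mset k \<sigma>)" "wf_ubag \<Theta> Map.empty U \<epsilon>"
    unfolding wf_App_iff by blast
  from *(4) obtain L xs where "M = Share L xs x" "x \<notin> dom \<Gamma>\<^sub>1"
    "wf_trm (\<Theta>(x \<mapsto> \<eta>)) (\<Gamma>\<^sub>1(x \<mapsto> replicate_mset j \<sigma>)) M \<tau>"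
    unfolding wf_Lam_iff sty.inject by metis
  with * show ?case unfolding wf_ISub_iff by blast
next
  case (Ex_Sub C xs M x U)
  from Ex_Sub(4) obtain \<Gamma>\<^sub>1 \<Gamma>\<^sub>2 k \<sigma> \<eta> \<epsilon> where
    *: "\<Gamma> = \<Gamma>\<^sub>1 ++ \<Gamma>\<^sub>2" "dom \<Gamma>\<^sub>1 \<inter> dom \<Gamma>\<^sub>2 = {}" "\<eta> \<sim> \<epsilon>" "distinct xs" "set xs \<inter> dom \<Gamma>\<^sub>1 = {}"
      "wf_trm (\<Theta>(x \<mapsto> \<eta>)) (add_vars \<Gamma>\<^sub>1 xs \<sigma>) M \<tau>"
      "wf_lbag \<Theta> \<Gamma>\<^sub>2 C (replicate_mset k \<sigma>)" "wf_ubag \<Theta> Map.empty U \<epsilon>"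
    by (rule wf_ISub_Share)
  \<comment> \<open>Typing tolerates a mismatch between the bag and the shared variables; the side
    condition on sizes excludes it here.\<close>
  have "k = length xs"
    using wf_lbag_size[OF *(7)] Ex_Sub(1) by simp
  \<comment> \<open>After the step the linear bag lies in the scope of the unrestricted binder of
    \<open>x\<close>.\<close>
  have "wf_lbag (\<Theta>(x \<mapsto> \<eta>)) \<Gamma>\<^sub>2 C (replicate_mset k \<sigma>)"
  proof (rule wf_lbag_cong_uctx[OF *(7)])
    show "(\<Theta>(x \<mapsto> \<eta>)) z = \<Theta> z" if "z \<in> ufv_lbag C" for z
      using that Ex_Sub(3) by (metis fun_upd_other)
  qed
  then have "wf_trm (\<Theta>(x \<mapsto> \<eta>)) \<Gamma> (LSub M C xs) \<tau>"
    unfolding *(1) using * \<open>k = length xs\<close> by (intro esub_lin) auto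
  then show ?case using *(8,3) by (rule esub_unr)
next
  case (Fetch_lin M y N C xs ys)
  let ?zs = "xs @ y # ys"
  from Fetch_lin(7) obtain \<Gamma>\<^sub>1 \<Gamma>\<^sub>2 \<sigma> where
    *: "\<Gamma> = \<Gamma>\<^sub>1 ++ \<Gamma>\<^sub>2" "dom \<Gamma>\<^sub>1 \<inter> dom \<Gamma>\<^sub>2 = {}" "set ?zs \<inter> dom \<Gamma>\<^sub>1 = {}"
      "wf_trm \<Theta> (add_vars \<Gamma>\<^sub>1 ?zs \<sigma>) M \<tau>" "wf_lbag \<Theta> \<Gamma>\<^sub>2 C (replicate_mset (length ?zs) \<sigma>)"
    unfolding wf_LSub_iff by blast
  from wf_lbag_remove[OF *(5) Fetch_lin(2)] obtain \<Delta>\<^sub>1 \<Delta>\<^sub>2 \<rho> k where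
    **: "\<Gamma>\<^sub>2 = \<Delta>\<^sub>1 ++ \<Delta>\<^sub>2" "dom \<Delta>\<^sub>1 \<inter> dom \<Delta>\<^sub>2 = {}" "wf_trm \<Theta> \<Delta>\<^sub>1 N \<rho>"
      "replicate_mset (length ?zs) \<sigma> = replicate_mset (k + 1) \<rho>"
      "wf_lbag \<Theta> \<Delta>\<^sub>2 (C - {#N#}) (replicate_mset k \<rho>)"
    by blast
  have k: "k = length (xs @ ys)"
    using arg_cong[OF **(4), of size] by simp
  have \<rho>: "\<rho> = \<sigma>"
    using **(4) by (metis in_replicate_mset zero_less_Suc Suc_eq_plus1)
  have N: "dom \<Delta>\<^sub>1 = lfv N" using **(3) by (rule wf_trm_dom)
  have "wf_trm \<Theta> ((add_vars \<Gamma>\<^sub>1 ?zs \<sigma>)(y := None) ++ \<Delta>\<^sub>1) (head_subst (Var y) N M) \<tau>"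
  proof (rule wf_head_subst_lin[OF *(4) Fetch_lin(1) _ _ **(3)[unfolded \<rho>]])
    \<comment> \<open>\<open>y\<close> is left out because it may be free in the fetched term: the
      reduct no longer binds it.\<close>
    show "(dom (add_vars \<Gamma>\<^sub>1 ?zs \<sigma>) - {y}) \<inter> dom \<Delta>\<^sub>1 = {}"
      using Fetch_lin(6) *(1,2) **(1) unfolding N[symmetric] by auto
  qed (use Fetch_lin(4,5,8) N in \<open>auto simp: add_vars_def map_add_def\<close>)
  moreover have "(add_vars \<Gamma>\<^sub>1 ?zs \<sigma>)(y := None) ++ \<Delta>\<^sub>1 = add_vars (\<Gamma>\<^sub>1 ++ \<Delta>\<^sub>1) (xs @ ys) \<sigma>"
    using Fetch_lin(3,6) *(3) unfolding N[symmetric]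
    by (auto simp: fun_eq_iff add_vars_def map_add_def split: option.splits)
  moreover have "\<Gamma> = (\<Gamma>\<^sub>1 ++ \<Delta>\<^sub>1) ++ \<Delta>\<^sub>2"
    using *(1) **(1) by simp
  moreover have "dom (\<Gamma>\<^sub>1 ++ \<Delta>\<^sub>1) \<inter> dom \<Delta>\<^sub>2 = {}" "set (xs @ ys) \<inter> dom (\<Gamma>\<^sub>1 ++ \<Delta>\<^sub>1) = {}"
    using *(2,3) **(1,2) Fetch_lin(6) unfolding N[symmetric] by auto
  moreover have "distinct (xs @ ys)" using Fetch_lin(3) by simp
  ultimately show ?case
    using **(5) unfolding k \<rho> wf_LSub_iff by metis
next
  case (Fail_lin C xs Y M x U)
  from Fail_lin(3) obtain \<Gamma>\<^sub>1 \<Gamma>\<^sub>2 k \<sigma> \<eta> \<epsilon> where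
    *: "\<Gamma> = \<Gamma>\<^sub>1 ++ \<Gamma>\<^sub>2" "set xs \<inter> dom \<Gamma>\<^sub>1 = {}" "wf_trm (\<Theta>(x \<mapsto> \<eta>)) (add_vars \<Gamma>\<^sub>1 xs \<sigma>) M \<tau>"
      "wf_lbag \<Theta> \<Gamma>\<^sub>2 C (replicate_mset k \<sigma>)"
    by (rule wf_ISub_Share)
  have "dom \<Gamma>\<^sub>1 = lfv M - set xs"
    using wf_trm_dom[OF *(3)] *(2) by (auto simp del: domIff)
  then have "dom \<Gamma> = fset Y"
    using wf_lbag_dom[OF *(4)] *(1) Fail_lin(2) by (simp add: Un_commute)
  with Fail_lin(5) show ?case by (intro wf_FailI) auto
next
  case (Fetch_unr M x i U N)
  from Fetch_unr(6) obtain \<eta> \<epsilon> where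
    *: "\<eta> \<sim> \<epsilon>" "wf_trm (\<Theta>(x \<mapsto> \<eta>)) \<Gamma> M \<tau>" "wf_ubag \<Theta> Map.empty U \<epsilon>"
    unfolding wf_USub_iff by blast
  have "wf_trm (\<Theta>(x \<mapsto> \<eta>)) Map.empty N (list_of \<eta> ! (i - 1))" if "1 \<le> i" "i \<le> length (list_of \<eta>)"
  proof -
    \<comment> \<open>The bag is typed against \<open>\<epsilon>\<close>, the occurrence against
      \<open>\<eta>\<close>; as \<open>\<eta>\<close> is a prefix of \<open>\<epsilon>\<close>, they
      agree at every position within \<open>\<eta>\<close>.\<close>
    have "list_of \<eta> ! (i - 1) = list_of \<epsilon> ! (i - 1)" "i \<le> length (list_of \<epsilon>)"
      using *(1) that by (auto simp: prefix_def nth_append)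
    with wf_ubag_at[OF *(3) Fetch_unr(2)] that
    have "wf_trm \<Theta> Map.empty N (list_of \<eta> ! (i - 1))" by simp
    then show ?thesis by (rule wf_trm_cong_uctx) (use Fetch_unr(5) in auto)
  qed
  then have "wf_trm (\<Theta>(x \<mapsto> \<eta>)) \<Gamma> (head_subst (UVar x i) N M) \<tau>"
    using Fetch_unr(4) by (intro wf_head_subst_unr[OF *(2) Fetch_unr(1)]) auto
  with *(1,3) show ?case unfolding wf_USub_iff by blast
next
  case (Fail_unr M x i U)
  from Fail_unr(4) obtain \<eta> \<epsilon> where
    *: "\<eta> \<sim> \<epsilon>" "wf_trm (\<Theta>(x \<mapsto> \<eta>)) \<Gamma> M \<tau>" "wf_ubag \<Theta> Map.empty U \<epsilon>"
    unfolding wf_USub_iff by blast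
  \<comment> \<open>\<open>Fail {||}\<close> has every type in the empty linear context, so it fits
    whatever type the missing component should have.\<close>
  have "wf_trm (\<Theta>(x \<mapsto> \<eta>)) \<Gamma> (head_subst (UVar x i) (Fail {||}) M) \<tau>"
    using Fail_unr(3) by (intro wf_head_subst_unr[OF *(2) Fail_unr(1)]) (auto simp: wf_Fail_iff)
  with *(1,3) show ?case unfolding wf_USub_iff by blast
next
  case (Cons1 Z X C U)
  from Cons1(2) obtain \<Gamma>\<^sub>1 \<Gamma>\<^sub>2 \<rho> \<pi> where
    *: "\<Gamma> = \<Gamma>\<^sub>1 ++ \<Gamma>\<^sub>2" "wf_trm \<Theta> \<Gamma>\<^sub>1 (Fail X) \<rho>" "wf_lbag \<Theta> \<Gamma>\<^sub>2 C \<pi>"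
    unfolding wf_App_iff by blast
  have "dom \<Gamma> = fset Z"
    using wf_trm_dom[OF *(2)] wf_lbag_dom[OF *(3)] *(1) Cons1(1) by (simp add: Un_commute)
  with Cons1(4) show ?case by (intro wf_FailI) auto
next
  case (Cons2 C xs X Y Z x U)
  from Cons2(5) obtain \<Gamma>\<^sub>1 \<Gamma>\<^sub>2 k \<sigma> \<eta> \<epsilon> where
    *: "\<Gamma> = \<Gamma>\<^sub>1 ++ \<Gamma>\<^sub>2" "set xs \<inter> dom \<Gamma>\<^sub>1 = {}"
      "wf_trm (\<Theta>(x \<mapsto> \<eta>)) (add_vars \<Gamma>\<^sub>1 xs \<sigma>) (Fail X) \<tau>" "wf_lbag \<Theta> \<Gamma>\<^sub>2 C (replicate_mset k \<sigma>)"
    by (rule wf_ISub_Share)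
  \<comment> \<open>Disjointness makes \<open>Y\<close> exactly \<open>X\<close> without the bound
    variables, which is what the context retains outside the binder.\<close>
  have "dom \<Gamma>\<^sub>1 = fset Y"
    using wf_trm_dom[OF *(3)] *(2) Cons2(2,3) by (auto simp del: domIff)
  then have "dom \<Gamma> = fset Z"
    using wf_lbag_dom[OF *(4)] *(1) Cons2(4) by (simp add: Un_commute)
  with Cons2(7) show ?case by (intro wf_FailI) auto
next
  case (Cons3 X Y xs Z C)
  from Cons3(4) obtain \<Gamma>\<^sub>1 \<Gamma>\<^sub>2 \<sigma> where
    *: "\<Gamma> = \<Gamma>\<^sub>1 ++ \<Gamma>\<^sub>2" "set xs \<inter> dom \<Gamma>\<^sub>1 = {}" "wf_trm \<Theta> (add_vars \<Gamma>\<^sub>1 xs \<sigma>) (Fail X) \<tau>"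
      "wf_lbag \<Theta> \<Gamma>\<^sub>2 C (replicate_mset (length xs) \<sigma>)"
    unfolding wf_LSub_iff by blast
  have "dom \<Gamma>\<^sub>1 = fset Y"
    using wf_trm_dom[OF *(3)] *(2) Cons3(1,2) by (auto simp del: domIff)
  then have "dom \<Gamma> = fset Z"
    using wf_lbag_dom[OF *(4)] *(1) Cons3(3) by (simp add: Un_commute)
  with Cons3(6) show ?case by (intro wf_FailI) auto
next
  case (Cons4 Y U x)
  then show ?case unfolding wf_USub_iff wf_Fail_iff by blast
next
  case (TCont M N E)
  show ?case
    by (rule wf_plug[OF TCont.prems TCont.IH])
next
  case (Alpha M M' N' N)
  \<comment> \<open>Typing and \<open>spine_ok\<close> are carried forward from \<open>M\<close> to
    \<open>M'\<close>, the condition on recorded variables backward from \<open>N\<close> to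
    \<open>N'\<close>.\<close>
  have "wf_trm \<Theta> \<Gamma> N' \<tau>"
    using Alpha.prems Alpha.hyps
    by (intro Alpha.IH) (auto intro: wf_trm_alpha_eq alpha_spine_ok simp: alpha_eq_spine_fail)
  then show ?case using Alpha.hyps(3) by (rule wf_trm_alpha_eq[rotated])
qed

theorem theorem3p4:
  fixes M M' :: trm and \<Theta> :: uctx and \<Gamma> :: lctx and \<tau> :: sty
  assumes "finite (dom \<Theta>)" and "finite (dom \<Gamma>)"
    and "lc_term M"
    and "\<And>z. \<Gamma> z = Some {#} \<Longrightarrow> z \<notin> fail_vars M'"
    and "wf_trm \<Theta> \<Gamma> M \<tau>"
    and "M \<longlongrightarrow>\<^sub>C M'"
  shows "wf_trm \<Theta> \<Gamma> M' \<tau>"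
  using assms(6,5)
proof (rule red_preserves_wf)
  show "spine_ok M" using assms(3) by (rule lc_term_spine_ok)
  show "z \<notin> spine_fail M'" if "\<Gamma> z = Some {#}" for z
    using assms(4)[OF that] spine_fail_subset by blast
qed

end
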